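(* Let $N, N_c, L\ge 1$ be integers with $L\ge N$. For $1\le i\le N_c$ and $1\le j\le N$ let $\mathbf{h}_{ij}\in\mathbb{C}^{1\times L}$ be row vectors, let $w_1>w_2>\cdots>w_N\ge 0$ be real weights, and let $P_1^{tot},\dots,P_L^{tot}>0$ be power budgets. Consider the primal problem (weighted sum rate maximization in the broadcast channel under per-modem total power constraints) $$p^\star=\max_{(\mathbf{Q}_{ij})} C^{BC}\big((\mathbf{Q}_{ij})\big)\quad\text{subject to}\quad \sum_{j=1}^{N}\sum_{i=1}^{N_c}(\mathbf{Q}_{ij})_{ll}\le P_l^{tot}\ \ (1\le l\le L),\qquad \mathbf{Q}_{ij}\succeq 0\ \ \text{for all } i,j,$$ and its Lagrange dual problem $$d^\star=\min_{\lambda_1,\dots,\lambda_L\ge 0} F^{BC}(\mathbf{\Lambda}),\qquad \mathbf{\Lambda}=\mathrm{diag}(\lambda_1,\dots,\lambda_L),$$ where $C^{BC}$ and $F^{BC}$ are the weighted rate sum function and the dual objective function defined in the context. Then the two problems have the same optimal value, i.e. the duality gap is zero: $p^\star=d^\star$.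
   Context: Here $N$ is the number of users, $N_c$ the number of tones, $L$ the number of modems (transmit lines), and $\mathbf{h}_{ij}$ is the channel row vector of user $j$ on tone $i$; the noise has identity covariance. The optimization variables $\mathbf{Q}_{ij}\in\mathbb{C}^{L\times L}$ ($1\le i\le N_c$, $1\le j\le N$) are Hermitian positive semidefinite matrices (transmit covariance matrix of user $j$ on tone $i$), and $(\mathbf{Q}_{ij})_{ll}$ denotes the $l$-th diagonal entry. $(\cdot)^H$ is the conjugate transpose. The weighted rate sum function for dirty paper coding with encoding order $1,2,\dots,N$ (user 1 encoded first) is $$C^{BC}\big((\mathbf{Q}_{ij})\big)=\sum_{j=1}^{N} w_j\sum_{i=1}^{N_c}\log_2\!\left[1+\mathbf{h}_{ij}\mathbf{Q}_{ij}\mathbf{h}_{ij}^H\,a_{ij}^{-1}\right],\qquad a_{ij}=1+\mathbf{h}_{ij}\Big(\sum_{k=j+1}^{N}\mathbf{Q}_{ik}\Big)\mathbf{h}_{ij}^H .$$ For a diagonal matrix $\mathbf{\Lambda}=\mathrm{diag}(\lambda_1,\dots,\lambda_L)$ of nonnegative Lagrange multipliers, the dual objective function is $$F^{BC}(\mathbf{\Lambda})=\sup_{\mathbf{Q}_{ij}\succeq 0}\left\{C^{BC}\big((\mathbf{Q}_{ij})\big)-\sum_{i=1}^{N_c}\sum_{j=1}^{N}\mathrm{Trace}(\mathbf{\Lambda}\mathbf{Q}_{ij})+\sum_{l=1}^{L}\lambda_l P_l^{tot}\right\},$$ which may take the value $+\infty$. *)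

theory Defs
  imports "HOL-Analysis.Analysis"
begin

definition conj_transpose :: "complex ^ 'n ^ 'm \<Rightarrow> complex ^ 'm ^ 'n" where
  "conj_transpose A = (\<chi> i j. cnj (A $ j $ i))"

definition hermitian :: "complex ^ 'n ^ 'n \<Rightarrow> bool" where
  "hermitian A \<longleftrightarrow> conj_transpose A = A"

text \<open>The scalar \<open>h A h\<^sup>H\<close> for a row vector \<open>h\<close>.\<close>

definition herm_form :: "complex ^ 'n \<Rightarrow> complex ^ 'n ^ 'n \<Rightarrow> complex" where
  "herm_form h A = (\<Sum>l\<in>UNIV. (h v* A) $ l * cnj (h $ l))"

definition psd :: "complex ^ 'n ^ 'n \<Rightarrow> bool" where
  "psd A \<longleftrightarrow> hermitian A \<and> (\<forall>x. 0 \<le> Re (herm_form x A))"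

definition diag_mat :: "real ^ 'n \<Rightarrow> complex ^ 'n ^ 'n" where
  "diag_mat d = (\<chi> l m. if l = m then complex_of_real (d $ l) else 0)"

text \<open>The real parts taken in this theory lose nothing: on Hermitian matrices
  the quantities concerned are real.\<close>

lemma hermitian_nth: "hermitian A \<Longrightarrow> cnj (A $ j $ i) = A $ i $ j"
  unfolding hermitian_def conj_transpose_def by (drule arg_cong[where f = "\<lambda>B. B $ i $ j"]) simp

lemma herm_form_real:
  assumes "hermitian A"
  shows "herm_form h A \<in> \<real>"
proof -
  have eq: "herm_form h A = (\<Sum>l\<in>UNIV. \<Sum>m\<in>UNIV. h $ m * A $ m $ l * cnj (h $ l))"
    by (simp add: herm_form_def vector_matrix_mult_def sum_distrib_right)
  have "cnj (herm_form h A) = (\<Sum>l\<in>UNIV. \<Sum>m\<in>UNIV. h $ l * A $ l $ m * cnj (h $ m))"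
    unfolding eq by (simp add: hermitian_nth[OF assms] mult_ac)
  also have "\<dots> = herm_form h A"
    unfolding eq by (rule sum.swap)
  finally show ?thesis
    by (simp add: Reals_cnj_iff)
qed

lemma hermitian_diag_real: "hermitian A \<Longrightarrow> A $ l $ l \<in> \<real>"
  by (simp add: Reals_cnj_iff hermitian_nth)

lemma trace_diag_mat_mult:
  "trace (diag_mat d ** A) = (\<Sum>l\<in>UNIV. complex_of_real (d $ l) * A $ l $ l)"
proof -
  have "(\<Sum>k\<in>UNIV. diag_mat d $ l $ k * A $ k $ l) = complex_of_real (d $ l) * A $ l $ l" for l
    using sum.delta[of UNIV l "\<lambda>k. complex_of_real (d $ l) * A $ k $ l"]
    by (simp add: diag_mat_def if_distrib[where f = "\<lambda>x. x * _"] cong: if_cong)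
  then show ?thesis
    by (simp add: trace_def matrix_matrix_mult_def)
qed

text \<open>Tones are indexed by \<open>{1..Nc}\<close>, users by \<open>{1..N}\<close> and transmit lines by the type
  \<open>'l\<close>; \<open>h i j\<close> and \<open>Q i j\<close> belong to tone \<open>i\<close> and user \<open>j\<close>, and their values outside the index
  ranges are irrelevant.\<close>

definition interference ::
  "nat \<Rightarrow> (nat \<Rightarrow> nat \<Rightarrow> complex ^ 'l) \<Rightarrow> (nat \<Rightarrow> nat \<Rightarrow> complex ^ 'l ^ 'l) \<Rightarrow> nat \<Rightarrow> nat \<Rightarrow> real" where
  "interference N h Q i j = 1 + Re (herm_form (h i j) (\<Sum>k=j+1..N. Q i k))"

definition C_BC ::
  "nat \<Rightarrow> nat \<Rightarrow> (nat \<Rightarrow> nat \<Rightarrow> complex ^ 'l) \<Rightarrow> (nat \<Rightarrow> real) \<Rightarrow> (nat \<Rightarrow> nat \<Rightarrow> complex ^ 'l ^ 'l) \<Rightarrow> real" where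
  "C_BC N Nc h w Q =
     (\<Sum>j=1..N. w j * (\<Sum>i=1..Nc.
        log 2 (1 + Re (herm_form (h i j) (Q i j)) / interference N h Q i j)))"

definition psd_family :: "nat \<Rightarrow> nat \<Rightarrow> (nat \<Rightarrow> nat \<Rightarrow> complex ^ 'l ^ 'l) set" where
  "psd_family N Nc = {Q. \<forall>i\<in>{1..Nc}. \<forall>j\<in>{1..N}. psd (Q i j)}"

definition feasible ::
  "nat \<Rightarrow> nat \<Rightarrow> real ^ 'l \<Rightarrow> (nat \<Rightarrow> nat \<Rightarrow> complex ^ 'l ^ 'l) set" where
  "feasible N Nc P =
     {Q \<in> psd_family N Nc. \<forall>l. (\<Sum>j=1..N. \<Sum>i=1..Nc. Re (Q i j $ l $ l)) \<le> P $ l}"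

definition F_BC ::
  "nat \<Rightarrow> nat \<Rightarrow> (nat \<Rightarrow> nat \<Rightarrow> complex ^ 'l) \<Rightarrow> (nat \<Rightarrow> real) \<Rightarrow> real ^ 'l \<Rightarrow> real ^ 'l \<Rightarrow> ereal" where
  "F_BC N Nc h w P lam =
     (SUP Q\<in>psd_family N Nc. ereal
        (C_BC N Nc h w Q
         - (\<Sum>i=1..Nc. \<Sum>j=1..N. Re (trace (diag_mat lam ** Q i j)))
         + (\<Sum>l\<in>UNIV. lam $ l * P $ l)))"

definition primal_value ::
  "nat \<Rightarrow> nat \<Rightarrow> (nat \<Rightarrow> nat \<Rightarrow> complex ^ 'l) \<Rightarrow> (nat \<Rightarrow> real) \<Rightarrow> real ^ 'l \<Rightarrow> ereal" where
  "primal_value N Nc h w P = (SUP Q\<in>feasible N Nc P. ereal (C_BC N Nc h w Q))"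

definition dual_value ::
  "nat \<Rightarrow> nat \<Rightarrow> (nat \<Rightarrow> nat \<Rightarrow> complex ^ 'l) \<Rightarrow> (nat \<Rightarrow> real) \<Rightarrow> real ^ 'l \<Rightarrow> ereal" where
  "dual_value N Nc h w P = (INF lam\<in>{lam. \<forall>l. 0 \<le> lam $ l}. F_BC N Nc h w P lam)"

end

(* Write f(h,Q) for h Q h^H. Fix the multipliers lambda > 0 and one tone. A covariance family Q_j
   gives rates log(1 + gamma_j); in the dual multiple access channel with noise covariance
   Lambda = diag(lambda), take powers q_j giving the same rates when the covariances are
   M_j = Lambda + sum_{k<=j} q_k h_k^H h_k. Then log(1 + gamma_j) = log det M_j - log det M_{j-1} and
   sum q_j <= sum trace(Lambda Q_j), and since the weights decrease, the weighted rate sum is a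
   nonnegative combination of the functions log det M_j, which are concave in q.
   A first-order stationary point Q of the (nonconcave) broadcast Lagrangian satisfies
   Q_j = w_j (M_{j-1}^{-1} - M_j^{-1}) with q_j = w_j (1/a_j - 1/b_j), where b_j = a_j + f(h_j,Q_j), and
   this turns the stationarity conditions into those of the concave problem in q; hence every
   stationary point is a global maximiser of the Lagrangian. A primal optimum exists by compactness,
   maximises the linearised objective over the convex feasible set, and so is stationary for some
   multipliers, which close the duality gap. Multipliers that vanish belong to lines on which every
   channel of positive weight vanishes; those lines are deleted. *)

theory Submission
  imports Defs "Jordan_Normal_Form.Schur_Decomposition"
begin

no_notation vec_index (infixl \<open>$\<close> 100)
no_notation Matrix.scalar_prod (infix \<open>\<bullet>\<close> 70)
hide_const (open) Determinant.det Matrix.mat Matrix.row Matrix.col Matrix.vec Matrix.diag_mat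
hide_fact (open) Matrix.diag_mat_def

section \<open>Determinant and trace through eigenvalues\<close>

text \<open>The rate sum is not concave in the covariances, so Slater's argument is applied to its
  linearisation at an optimum, and the real work is the sufficiency of the resulting first-order
  conditions. The powers q_j originate in these conditions. User j interferes with the users m < j,
  and the derivative of w_m (ln b_m - ln a_m) in the interference at m is -w_m (1/a_m - 1/b_m) =
  -q_m. So q_m is the price of interference at user m, and the total price of a covariance of user j
  is its trace against Lambda + sum_{m<j} q_m h_m^H h_m, which is M_{j-1}: the dual channel is built
  from these prices. For an arbitrary competitor the passage to powers only bounds the cost from
  below; at a stationary point complementary slackness makes it exact, and the two facts carry the
  concave comparison back to the broadcast channel. The matrix analysis rests on eigenvalues of
  possibly non-Hermitian products, read off a triangular form, and on Cauchy-Schwarz.\<close>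

definition idx :: "nat \<Rightarrow> 'n::finite" where
  "idx = (SOME f. bij_betw f {0..<CARD('n)} UNIV)"

lemma bij_idx: "bij_betw (idx :: nat \<Rightarrow> 'n::finite) {0..<CARD('n)} UNIV"
proof -
  obtain f :: "nat \<Rightarrow> 'n" where f: "bij_betw f {0..<CARD('n)} UNIV"
    using ex_bij_betw_nat_finite[OF finite[of "UNIV :: 'n set"]] by blast
  show ?thesis
    unfolding idx_def by (rule someI[of "\<lambda>f. bij_betw f {0..<CARD('n)} UNIV", OF f])
qed

text \<open>Matrices over \<open>nat\<close> index ranges come with the Schur decomposition.\<close>

definition jmat :: "complex ^ 'n ^ 'n \<Rightarrow> complex Matrix.mat" where
  "jmat A = Matrix.mat CARD('n) CARD('n) (\<lambda>(i, j). A $ idx i $ idx j)"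

text \<open>Later arguments use multiplicativity, the value at the identity and the product of
  eigenvalues; the enumeration chosen in \<open>idx\<close> never shows.\<close>

definition cdet :: "complex ^ 'n ^ 'n \<Rightarrow> complex" where
  "cdet A = Determinant.det (jmat A)"

lemma jmat_carrier: "jmat (A :: complex ^ 'n ^ 'n) \<in> carrier_mat CARD('n) CARD('n)"
  by (simp add: jmat_def)

lemma sum_idx: "(\<Sum>k = 0..<CARD('n). g (idx k :: 'n::finite)) = (\<Sum>i\<in>UNIV. g i)"
  using sum.reindex_bij_betw[OF bij_idx] by simp

lemma jmat_mult: "jmat (A ** B) = jmat A * jmat B"
proof -
  have "(\<Sum>k\<in>UNIV. A $ idx i $ k * B $ k $ idx j)
      = (\<Sum>k = 0..<CARD('a). A $ idx i $ idx k * B $ idx k $ idx j)" for i j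
    by (rule sum_idx[symmetric])
  then show ?thesis
    by (intro eq_matI) (simp_all add: jmat_def matrix_matrix_mult_def scalar_prod_def)
qed

lemma idx_eq_iff: "i < CARD('n) \<Longrightarrow> j < CARD('n) \<Longrightarrow> (idx i :: 'n::finite) = idx j \<longleftrightarrow> i = j"
  using bij_idx[where 'n='n] by (auto simp: bij_betw_def inj_on_def)

lemma cdet_mat_1: "cdet (mat 1 :: complex ^ 'n ^ 'n) = 1"
proof -
  have "jmat (mat 1 :: complex ^ 'n ^ 'n) = 1\<^sub>m CARD('n)"
    by (intro eq_matI) (auto simp: jmat_def Finite_Cartesian_Product.mat_def idx_eq_iff)
  then show ?thesis by (simp add: cdet_def)
qed

lemma cdet_mult: "cdet (A ** B) = cdet A * cdet B"
  by (simp add: cdet_def jmat_mult Determinant.det_mult[OF jmat_carrier jmat_carrier])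

lemma sum_diag_mult_commute:
  fixes A B :: "complex Matrix.mat"
  assumes "A \<in> carrier_mat n n" "B \<in> carrier_mat n n"
  shows "(\<Sum>i = 0..<n. (A * B) $$ (i, i)) = (\<Sum>i = 0..<n. (B * A) $$ (i, i))"
proof -
  have "(\<Sum>i = 0..<n. (A * B) $$ (i, i)) = (\<Sum>i = 0..<n. \<Sum>k = 0..<n. A $$ (i, k) * B $$ (k, i))"
    using assms by (intro sum.cong) (auto simp: scalar_prod_def)
  also have "\<dots> = (\<Sum>k = 0..<n. \<Sum>i = 0..<n. A $$ (i, k) * B $$ (k, i))"
    by (rule sum.swap)
  also have "\<dots> = (\<Sum>i = 0..<n. (B * A) $$ (i, i))"
    using assms by (intro sum.cong) (auto simp: scalar_prod_def mult_ac)
  finally show ?thesis .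
qed

lemma jmat_eigenvector:
  fixes A :: "complex ^ 'n ^ 'n"
  assumes "eigenvalue (jmat A) e"
  shows "\<exists>v. v \<noteq> 0 \<and> A *v v = e *s v"
proof -
  let ?n = "CARD('n)"
  obtain u where u: "u \<in> carrier_vec ?n" "u \<noteq> 0\<^sub>v ?n" "jmat A *\<^sub>v u = e \<cdot>\<^sub>v u"
    using assms unfolding eigenvalue_def eigenvector_def by (auto simp: jmat_def)
  define v :: "complex ^ 'n" where "v = (\<chi> i. vec_index u (inv_into {0..<?n} idx i))"
  have v: "v $ idx k = vec_index u k" if "k < ?n" for k
    using that bij_betw_inv_into_left[OF bij_idx[where 'n='n]] by (simp add: v_def)
  obtain k where "k < ?n" "vec_index u k \<noteq> 0"
    using u(1,2) by (metis eq_vecI index_zero_vec(1) index_zero_vec(2) carrier_vecD)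
  then have "v \<noteq> 0"
    using v by force
  moreover have "(A *v v) $ i = (e *s v) $ i" for i
  proof -
    obtain k where k: "k < ?n" "i = idx k"
      using bij_idx[where 'n='n] by (metis UNIV_I atLeastLessThan_iff bij_betw_imp_surj_on imageE)
    have "(A *v v) $ i = (\<Sum>m = 0..<?n. A $ i $ idx m * v $ idx m)"
      unfolding matrix_vector_mult_def
      using sum_idx[of "\<lambda>m. A $ i $ m * v $ m"] by simp
    also have "\<dots> = vec_index (jmat A *\<^sub>v u) k"
      using k u(1) by (simp add: jmat_def scalar_prod_def v)
    also have "\<dots> = (e *s v) $ i"
      using k u v by (simp add: vector_scalar_mult_def)
    finally show ?thesis .
  qed
  ultimately show ?thesis
    by (metis Finite_Cartesian_Product.vec_eq_iff)
qed

text \<open>The Schur form is upper triangular with the roots of the characteristic polynomial on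
  its diagonal, so by similarity one list yields both determinant and trace. One eigenvector per
  entry is claimed, which holds for non-Hermitian products as well.\<close>

lemma eigenvalue_list:
  fixes A :: "complex ^ 'n ^ 'n"
  obtains es where "length es = CARD('n)" "cdet A = prod_list es" "trace A = sum_list es"
    "\<And>e. e \<in> set es \<Longrightarrow> \<exists>v. v \<noteq> 0 \<and> A *v v = e *s v"
proof -
  let ?n = "CARD('n)"
  have A: "jmat A \<in> carrier_mat ?n ?n" by (rule jmat_carrier)
  obtain es where es: "char_poly (jmat A) = (\<Prod>a\<leftarrow>es. [:- a, 1:])" "length es = ?n"
    using char_poly_factorized[OF A] by blast
  obtain B P Q where "schur_decomposition (jmat A) es = (B, P, Q)"
    by (cases "schur_decomposition (jmat A) es") auto
  from schur_decomposition[OF A es(1) this] have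
    s: "similar_mat_wit (jmat A) B P Q" and B: "upper_triangular B" "Matrix.diag_mat B = es" by auto
  note w = similar_mat_witD2[OF A s]
  have "Determinant.det (jmat A) = Determinant.det B"
    using s by (intro det_similar) (auto simp: similar_mat_def)
  then have 1: "cdet A = prod_list es"
    by (simp add: cdet_def det_upper_triangular[OF B(1) w(5)] B(2))
  have "trace A = (\<Sum>i = 0..<?n. jmat A $$ (i, i))"
    unfolding trace_def using sum_idx[of "\<lambda>i. A $ i $ i"] by (simp add: jmat_def)
  also have "\<dots> = (\<Sum>i = 0..<?n. ((P * B) * Q) $$ (i, i))"
    using w(3) by simp
  also have "\<dots> = (\<Sum>i = 0..<?n. (Q * (P * B)) $$ (i, i))"
    using w by (intro sum_diag_mult_commute) auto
  also have "Q * (P * B) = B"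
    using w by (metis assoc_mult_mat left_mult_one_mat)
  also have "(\<Sum>i = 0..<?n. B $$ (i, i)) = sum_list (Matrix.diag_mat B)"
    using w(5) by (simp add: Matrix.diag_mat_def interv_sum_list_conv_sum_set_nat)
  finally have 2: "trace A = sum_list es" using B by simp
  have 3: "\<exists>v. v \<noteq> 0 \<and> A *v v = e *s v" if "e \<in> set es" for e
  proof -
    have "poly (char_poly (jmat A)) e = 0"
      using that unfolding es(1) by (induct es) auto
    then show ?thesis
      using eigenvalue_root_char_poly[OF A] jmat_eigenvector by blast
  qed
  show ?thesis using that[OF es(2) 1 2 3] .
qed

section \<open>Positive semidefinite matrices and the log-determinant\<close>

definition hdot :: "complex ^ 'n \<Rightarrow> complex ^ 'n \<Rightarrow> complex" where
  "hdot x y = (\<Sum>i\<in>UNIV. x $ i * cnj (y $ i))"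

definition sesq :: "complex ^ 'n ^ 'n \<Rightarrow> complex ^ 'n \<Rightarrow> complex ^ 'n \<Rightarrow> complex" where
  "sesq A x y = hdot (x v* A) y"

text \<open>The rank-one matrix \<open>z\<^sup>H z\<close>; its trace against \<open>A\<close> is
  \<open>z A z\<^sup>H\<close>.\<close>

definition outer :: "complex ^ 'n \<Rightarrow> complex ^ 'n ^ 'n" where
  "outer z = (\<chi> i j. cnj (z $ i) * z $ j)"

definition posdef :: "complex ^ 'n ^ 'n \<Rightarrow> bool" where
  "posdef A \<longleftrightarrow> hermitian A \<and> (\<forall>x. x \<noteq> 0 \<longrightarrow> 0 < Re (herm_form x A))"

lemma herm_form_eq_sesq: "herm_form x A = sesq A x x"
  by (simp add: herm_form_def sesq_def hdot_def)

lemma vmm_nth: "(x v* A) $ j = (\<Sum>i\<in>UNIV. x $ i * A $ i $ j)"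
  by (simp add: vector_matrix_mult_def mult.commute)

lemma sesq_eq_sum: "sesq A x y = (\<Sum>i\<in>UNIV. \<Sum>j\<in>UNIV. x $ i * A $ i $ j * cnj (y $ j))"
  unfolding sesq_def hdot_def vmm_nth sum_distrib_right by (rule sum.swap)

lemma hdot_diff_left: "hdot (x - y) z = hdot x z - hdot y z"
  and hdot_scale_left: "hdot (c *s x) z = c * hdot x z"
  by (simp_all add: hdot_def ring_distribs sum_subtractf sum_distrib_left mult_ac)

lemma hdot_commute: "hdot x y = cnj (hdot y x)"
  by (simp add: hdot_def mult.commute)

lemma hdot_self: "hdot x x = of_real (\<Sum>i\<in>UNIV. (cmod (x $ i))\<^sup>2)"
  unfolding hdot_def of_real_sum complex_norm_square ..

lemma hdot_self_eq_0: "hdot x x = 0 \<longleftrightarrow> x = 0"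
proof -
  have "hdot x x = 0 \<longleftrightarrow> (\<Sum>i\<in>UNIV. (cmod (x $ i))\<^sup>2) = 0"
    unfolding hdot_self of_real_eq_0_iff ..
  also have "\<dots> \<longleftrightarrow> x = 0"
    by (subst sum_nonneg_eq_0_iff) (auto simp: Finite_Cartesian_Product.vec_eq_iff)
  finally show ?thesis .
qed

lemma eq_0_if_hdot: "(\<And>y. hdot x y = 0) \<Longrightarrow> x = 0"
  using hdot_self_eq_0 by blast

lemma sesq_diff_left: "sesq A (x - y) z = sesq A x z - sesq A y z"
  and sesq_scale_left: "sesq A (c *s x) z = c * sesq A x z"
  and sesq_diff_right: "sesq A z (x - y) = sesq A z x - sesq A z y"
  and sesq_scale_right: "sesq A z (c *s x) = cnj c * sesq A z x"
  unfolding sesq_eq_sum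
  by (simp_all add: ring_distribs sum.distrib sum_subtractf sum_distrib_left mult_ac)

lemma sesq_hermitian:
  assumes "hermitian A"
  shows "sesq A y x = cnj (sesq A x y)"
proof -
  have "cnj (sesq A x y) = (\<Sum>i\<in>UNIV. \<Sum>j\<in>UNIV. y $ j * A $ j $ i * cnj (x $ i))"
    unfolding sesq_eq_sum by (simp add: hermitian_nth[OF assms] mult_ac)
  also have "\<dots> = sesq A y x"
    unfolding sesq_eq_sum by (rule sum.swap)
  finally show ?thesis by simp
qed

lemma sesq_self_real: "hermitian A \<Longrightarrow> of_real (Re (sesq A x x)) = sesq A x x"
  using herm_form_real[of A x] by (simp add: herm_form_eq_sesq)

lemma psd_form_nonneg: "psd A \<Longrightarrow> 0 \<le> Re (sesq A x x)"
  and psd_hermitian: "psd A \<Longrightarrow> hermitian A"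
  by (simp_all add: psd_def herm_form_eq_sesq)

lemma quadratic_nonneg_discriminant:
  fixes a b s :: real
  assumes "\<And>t. 0 \<le> a - 2 * t * s + t\<^sup>2 * b" "0 \<le> a" "0 \<le> b"
  shows "s\<^sup>2 \<le> a * b"
proof (cases "b = 0")
  case True
  have "s = 0"
  proof (rule ccontr)
    assume "s \<noteq> 0"
    then show False
      using assms(1)[of "(a + 1) / s"] assms(2) True by simp
  qed
  then show ?thesis using True by simp
next
  case False
  then have "0 < b" using assms(3) by simp
  have "0 \<le> a - 2 * (s / b) * s + (s / b)\<^sup>2 * b" by (rule assms(1))
  also have "\<dots> = a - s\<^sup>2 / b"
    using \<open>0 < b\<close> by (simp add: field_simps power2_eq_square)
  finally show ?thesis
    using \<open>0 < b\<close> by (simp add: field_simps)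
qed

text \<open>Expand the form at \<open>x - t u y\<close> for real \<open>t\<close>, where
  \<open>u\<close> rotates the mixed term onto its modulus, and take the discriminant in
  \<open>t\<close>.\<close>

lemma psd_Cauchy_Schwarz:
  assumes "psd A"
  shows "(cmod (sesq A x y))\<^sup>2 \<le> Re (sesq A x x) * Re (sesq A y y)"
proof (rule quadratic_nonneg_discriminant)
  let ?s = "sesq A x y"
  define u where "u = sgn ?s"
  have u: "cnj u * ?s = of_real (cmod ?s)" "cmod ?s = 0 \<or> cmod u = 1"
  proof -
    have "cnj ?s * ?s = of_real (cmod ?s * cmod ?s)"
      by (metis complex_norm_square mult.commute power2_eq_square)
    then show "cnj u * ?s = of_real (cmod ?s)"
      by (cases "?s = 0") (simp_all add: u_def sgn_eq field_simps)
    show "cmod ?s = 0 \<or> cmod u = 1" by (auto simp: u_def norm_sgn)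
  qed
  fix t :: real
  have "0 \<le> Re (sesq A (x - (of_real t * u) *s y) (x - (of_real t * u) *s y))"
    using assms by (rule psd_form_nonneg)
  also have "\<dots> = Re (sesq A x x) - 2 * t * cmod ?s + t\<^sup>2 * (cmod u)\<^sup>2 * Re (sesq A y y)"
  proof -
    have 1: "sesq A y x = cnj ?s" using assms psd_hermitian sesq_hermitian by blast
    have 2: "u * cnj ?s = of_real (cmod ?s)" using arg_cong[OF u(1), of cnj] by simp
    have "sesq A (x - (of_real t * u) *s y) (x - (of_real t * u) *s y)
      = sesq A x x - of_real t * (cnj u * ?s) - of_real t * (u * cnj ?s)
        + of_real (t\<^sup>2) * (u * cnj u) * sesq A y y"
      by (simp add: sesq_diff_left sesq_diff_right sesq_scale_left sesq_scale_right 1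
          algebra_simps power2_eq_square)
    also have "\<dots> = sesq A x x - of_real (2 * t * cmod ?s) + of_real (t\<^sup>2 * (cmod u)\<^sup>2) * sesq A y y"
      unfolding u(1) 2 complex_norm_square[symmetric] by (simp flip: complex_norm_square)
    finally show ?thesis by simp
  qed
  \<comment> \<open>Since \<open>sgn 0 = 0\<close>, the number \<open>u\<close> has modulus one or
    zero, hence an inequality.\<close>
  also have "\<dots> \<le> Re (sesq A x x) - 2 * t * cmod ?s + t\<^sup>2 * Re (sesq A y y)"
  proof -
    have "(cmod u)\<^sup>2 \<le> 1" by (auto simp: u_def norm_sgn)
    then have "t\<^sup>2 * (cmod u)\<^sup>2 * Re (sesq A y y) \<le> t\<^sup>2 * 1 * Re (sesq A y y)"
      using psd_form_nonneg[OF assms] by (intro mult_right_mono mult_left_mono) auto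
    then show ?thesis by simp
  qed
  finally show "0 \<le> Re (sesq A x x) - 2 * t * cmod ?s + t\<^sup>2 * Re (sesq A y y)" .
qed (use assms psd_form_nonneg in auto)

lemma psd_null:
  assumes "psd A" "Re (sesq A x x) = 0"
  shows "x v* A = 0"
proof (rule eq_0_if_hdot)
  fix y
  have "(cmod (sesq A x y))\<^sup>2 \<le> 0"
    using psd_Cauchy_Schwarz[OF assms(1), of x y] assms(2) by simp
  then show "hdot (x v* A) y = 0" by (simp add: sesq_def)
qed

text \<open>Forms act on rows while eigenvectors are columns; conjugating a column \<open>y\<close>
  turns \<open>y\<^sup>H A y\<close> into the form of \<open>A\<close> at a row.\<close>

definition vcnj :: "complex ^ 'n \<Rightarrow> complex ^ 'n" where
  "vcnj x = (\<chi> i. cnj (x $ i))"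

lemma vcnj_eq_0: "vcnj x = 0 \<longleftrightarrow> x = 0"
  by (simp add: vcnj_def Finite_Cartesian_Product.vec_eq_iff)

lemma sesq_vcnj: "sesq A (vcnj x) (vcnj y) = (\<Sum>i\<in>UNIV. cnj (x $ i) * (A *v y) $ i)"
  by (simp add: sesq_eq_sum vcnj_def matrix_vector_mult_def sum_distrib_left mult_ac)

lemma sesq_cols: "sesq A x (vcnj y) = (\<Sum>i\<in>UNIV. x $ i * (A *v y) $ i)"
  by (simp add: sesq_eq_sum vcnj_def matrix_vector_mult_def sum_distrib_left mult_ac)

text \<open>For an eigenpair \<open>e\<close>, \<open>v\<close> of \<open>A ** Q\<close> put
  \<open>y = Q v\<close>. Then \<open>y\<^sup>H A y = e (v\<^sup>H Q v)\<close>, so \<open>e\<close>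
  has nonnegative real part if the last factor is positive; if that factor vanishes, then
  \<open>Q v = 0\<close> and \<open>e = 0\<close>.\<close>

lemma trace_psd_mult_nonneg:
  assumes "psd A" "psd Q"
  shows "0 \<le> Re (trace (A ** Q))"
proof -
  obtain es where es: "trace (A ** Q) = sum_list es"
    "\<And>e. e \<in> set es \<Longrightarrow> \<exists>v. v \<noteq> 0 \<and> (A ** Q) *v v = e *s v"
    using eigenvalue_list[of "A ** Q"] by metis
  have "0 \<le> Re e" if e: "e \<in> set es" for e
  proof -
    obtain v where v: "v \<noteq> 0" "(A ** Q) *v v = e *s v" using es(2)[OF e] by blast
    let ?y = "Q *v v"
    have y: "A *v ?y = e *s v" using v(2) by (simp add: matrix_vector_mul_assoc)
    define d where "d = Re (sesq Q (vcnj v) (vcnj v))"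
    have d: "sesq Q (vcnj v) (vcnj v) = of_real d"
      unfolding d_def using assms(2) by (simp add: sesq_self_real psd_hermitian)
    have "sesq A (vcnj ?y) (vcnj ?y) = e * (\<Sum>i\<in>UNIV. cnj (?y $ i) * v $ i)"
      unfolding sesq_vcnj y by (simp add: sum_distrib_left mult_ac)
    also have "(\<Sum>i\<in>UNIV. cnj (?y $ i) * v $ i) = cnj (sesq Q (vcnj v) (vcnj v))"
      unfolding sesq_vcnj by (simp add: mult.commute)
    finally have A: "sesq A (vcnj ?y) (vcnj ?y) = e * of_real d" using d by simp
    show ?thesis
    proof (cases "d = 0")
      case True
      then have "vcnj v v* Q = 0"
        using psd_null[OF assms(2)] d by simp
      then have "sesq Q (vcnj v) x = 0" for x by (simp add: sesq_def hdot_def)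
      then have "sesq Q x (vcnj v) = 0" for x
        using sesq_hermitian[OF psd_hermitian[OF assms(2)], of x "vcnj v"] by simp
      then have "hdot ?y x = 0" for x
        using \<open>\<And>x. sesq Q x (vcnj v) = 0\<close>[of "vcnj x", unfolded sesq_cols]
        by (simp add: hdot_def vcnj_def mult.commute)
      then have "?y = 0" by (rule eq_0_if_hdot)
      then have "e *s v = 0" using y by simp
      then have "e = 0" using v(1) by simp
      then show ?thesis by simp
    next
      case False
      then have "0 < d"
        using psd_form_nonneg[OF assms(2), of "vcnj v"] d_def by linarith
      then show ?thesis
        using psd_form_nonneg[OF assms(1), of "vcnj ?y"] A
        by (simp add: zero_le_mult_iff)
    qed
  qed
  then have "0 \<le> Re (sum_list es)"
    by (induct es) auto
  then show ?thesis using es(1) by simp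
qed

lemma posdef_psd: "posdef A \<Longrightarrow> psd A"
proof -
  assume A: "posdef A"
  have "0 \<le> Re (herm_form x A)" for x
    using A by (cases "x = 0") (force simp: posdef_def herm_form_eq_sesq sesq_eq_sum)+
  then show "psd A" using A by (simp add: psd_def posdef_def)
qed

lemma posdef_form_pos: "posdef A \<Longrightarrow> x \<noteq> 0 \<Longrightarrow> 0 < Re (sesq A x x)"
  by (simp add: posdef_def herm_form_eq_sesq)

lemma posdef_eq_0:
  assumes "posdef A" "A *v x = 0"
  shows "x = 0"
proof (rule ccontr)
  assume "x \<noteq> 0"
  then have "0 < Re (sesq A (vcnj x) (vcnj x))"
    using assms posdef_form_pos vcnj_eq_0 by blast
  then show False using assms(2) unfolding sesq_vcnj by simp
qed

lemma posdef_inverse: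
  assumes "posdef A"
  shows "matrix_inv A ** A = mat 1" "A ** matrix_inv A = mat 1"
proof -
  have "\<exists>B. B ** A = mat 1"
    unfolding matrix_left_invertible_ker using posdef_eq_0[OF assms] by blast
  then have "\<exists>B. A ** B = mat 1 \<and> B ** A = mat 1"
    by (metis matrix_left_right_inverse)
  then have "A ** matrix_inv A = mat 1 \<and> matrix_inv A ** A = mat 1"
    unfolding matrix_inv_def by (rule someI_ex)
  then show "matrix_inv A ** A = mat 1" "A ** matrix_inv A = mat 1" by auto
qed

text \<open>The eigenvalues of \<open>B\<^sup>-\<^sup>1 A\<close> are positive although this matrix need not be Hermitian.\<close>

lemma eigenvalue_pencil_pos:
  assumes "posdef A" "posdef B" "v \<noteq> 0" "A *v v = e *s (B *v v)"
  shows "e = of_real (Re e)" "0 < Re e"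
proof -
  define a b where "a = Re (sesq A (vcnj v) (vcnj v))" and "b = Re (sesq B (vcnj v) (vcnj v))"
  have "vcnj v \<noteq> 0" using assms(3) vcnj_eq_0 by blast
  then have pos: "0 < a" "0 < b"
    using assms posdef_form_pos unfolding a_def b_def by blast+
  have "sesq A (vcnj v) (vcnj v) = e * sesq B (vcnj v) (vcnj v)"
    unfolding sesq_vcnj assms(4) by (simp add: sum_distrib_left mult_ac)
  then have "of_real a = e * of_real b"
    using assms(1,2) sesq_self_real unfolding a_def b_def posdef_def by metis
  then have "e = of_real (a / b)" using pos by (simp add: field_simps)
  then show "e = of_real (Re e)" "0 < Re e" using pos by simp_all
qed

text \<open>Sum the scalar bound \<open>ln e \<le> e - 1\<close>; reality and positivity travel
  through the induction because \<open>ln\<close> only sees the real part of the complex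
  product.\<close>

lemma prod_list_le_exp_sum:
  assumes "\<And>e. e \<in> set es \<Longrightarrow> e = complex_of_real (Re e) \<and> 0 < Re e"
  shows "prod_list es = of_real (Re (prod_list es)) \<and> 0 < Re (prod_list es)
    \<and> ln (Re (prod_list es)) \<le> Re (sum_list es) - length es"
  using assms
proof (induct es)
  case (Cons e es)
  then have IH: "prod_list es = of_real (Re (prod_list es))" "0 < Re (prod_list es)"
    "ln (Re (prod_list es)) \<le> Re (sum_list es) - length es" and e: "e = complex_of_real (Re e)" "0 < Re e"
    by auto
  have p: "prod_list (e # es) = of_real (Re e * Re (prod_list es))"
    using e(1) IH(1) by (metis of_real_mult prod_list.Cons)
  have "ln (Re e * Re (prod_list es)) \<le> (Re e - 1) + (Re (sum_list es) - length es)"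
    using e(2) IH by (simp add: ln_mult_pos add_mono ln_le_minus_one)
  then show ?case unfolding p using e(2) IH(2) by simp
qed simp

definition logdet :: "complex ^ 'n ^ 'n \<Rightarrow> real" where
  "logdet A = ln (Re (cdet A))"

lemma posdef_cdet_mult:
  fixes A B :: "complex ^ 'n ^ 'n"
  assumes "posdef A" "posdef B"
  shows "cdet (matrix_inv B ** A) = of_real (Re (cdet (matrix_inv B ** A)))"
    "0 < Re (cdet (matrix_inv B ** A))"
    "ln (Re (cdet (matrix_inv B ** A))) \<le> Re (trace (matrix_inv B ** A)) - CARD('n)"
proof -
  let ?X = "matrix_inv B ** A"
  obtain es where es: "length es = CARD('n)" "cdet ?X = prod_list es" "trace ?X = sum_list es"
    "\<And>e. e \<in> set es \<Longrightarrow> \<exists>v. v \<noteq> 0 \<and> ?X *v v = e *s v"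
    using eigenvalue_list[of ?X] by metis
  have "e = of_real (Re e) \<and> 0 < Re e" if e: "e \<in> set es" for e
  proof -
    obtain v where v: "v \<noteq> 0" "?X *v v = e *s v" using es(4)[OF e] by blast
    have "A *v v = (B ** (matrix_inv B ** A)) *v v"
      using posdef_inverse(2)[OF assms(2)] by (simp add: matrix_mul_assoc)
    also have "\<dots> = B *v (?X *v v)" by (simp add: matrix_vector_mul_assoc)
    also have "\<dots> = e *s (B *v v)"
      unfolding v(2) by (simp add: vector_scalar_commute)
    finally show ?thesis using eigenvalue_pencil_pos[OF assms v(1)] by blast
  qed
  from prod_list_le_exp_sum[OF this]
  show "cdet ?X = of_real (Re (cdet ?X))" "0 < Re (cdet ?X)"
    "ln (Re (cdet ?X)) \<le> Re (trace ?X) - CARD('n)"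
    unfolding es(2,3) es(1)[symmetric] by blast+
qed


lemma sesq_mat_1: "sesq (mat 1) x y = hdot x y"
  by (simp add: sesq_def)

lemma posdef_mat_1: "posdef (mat 1 :: complex ^ 'n ^ 'n)"
  unfolding posdef_def herm_form_eq_sesq sesq_mat_1
proof (intro conjI allI impI)
  show "hermitian (mat 1 :: complex ^ 'n ^ 'n)"
    by (auto simp: hermitian_def conj_transpose_def Finite_Cartesian_Product.mat_def
        Finite_Cartesian_Product.vec_eq_iff)
  fix x :: "complex ^ 'n" assume "x \<noteq> 0"
  then have "hdot x x \<noteq> 0" by (simp add: hdot_self_eq_0)
  then have "(\<Sum>i\<in>UNIV. (cmod (x $ i))\<^sup>2) \<noteq> 0" unfolding hdot_self of_real_eq_0_iff .
  moreover have "0 \<le> (\<Sum>i\<in>UNIV. (cmod (x $ i))\<^sup>2)" by (intro sum_nonneg) simp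
  ultimately show "0 < Re (hdot x x)" unfolding hdot_self by simp
qed

lemma posdef_cdet:
  fixes A :: "complex ^ 'n ^ 'n"
  assumes "posdef A"
  shows "cdet A = of_real (Re (cdet A))" "0 < Re (cdet A)"
proof -
  have "matrix_inv (mat 1) = (mat 1 :: complex ^ 'n ^ 'n)"
    using posdef_inverse(1)[OF posdef_mat_1, where 'a = 'n] by simp
  then have "matrix_inv (mat 1) ** A = A" by simp
  then show "cdet A = of_real (Re (cdet A))" "0 < Re (cdet A)"
    using posdef_cdet_mult[OF assms posdef_mat_1] by metis+
qed

text \<open>This is concavity of the log-determinant: the right side is its derivative at
  \<open>B\<close> in the direction \<open>A - B\<close>.\<close>

lemma logdet_tangent:
  fixes A B :: "complex ^ 'n ^ 'n"
  assumes "posdef A" "posdef B"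
  shows "logdet A - logdet B \<le> Re (trace (matrix_inv B ** A)) - CARD('n)"
proof -
  have "cdet (matrix_inv B) * cdet B = 1"
    using posdef_inverse(1)[OF assms(2)] cdet_mult cdet_mat_1 by metis
  then have "cdet A = cdet (matrix_inv B ** A) * cdet B"
    by (simp add: cdet_mult)
  then have "Re (cdet A) = Re (cdet (matrix_inv B ** A)) * Re (cdet B)"
    using posdef_cdet[OF assms(1)] posdef_cdet[OF assms(2)] posdef_cdet_mult[OF assms]
    by (metis Re_complex_of_real of_real_mult)
  then have "logdet A = ln (Re (cdet (matrix_inv B ** A))) + logdet B"
    unfolding logdet_def using posdef_cdet_mult(2)[OF assms] posdef_cdet(2)[OF assms(2)]
    by (simp add: ln_mult_pos)
  then show ?thesis using posdef_cdet_mult(3)[OF assms] by simp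
qed

text \<open>If \<open>k\<close> entries equal \<open>1 + c\<close>, the sum forces
  \<open>k * c = c\<close>, so \<open>k = 1\<close> unless \<open>c = 0\<close>, when both values
  are one.\<close>

lemma prod_list_two_values:
  fixes c :: complex
  assumes "\<And>e. e \<in> set es \<Longrightarrow> e = 1 \<or> e = 1 + c" "sum_list es = of_nat (length es) + c"
  shows "prod_list es = 1 + c"
proof -
  have "\<exists>k. prod_list es = (1 + c) ^ k \<and> sum_list es = of_nat (length es) + of_nat k * c"
    using assms(1)
  proof (induct es)
    case Nil
    then show ?case by (intro exI[of _ 0]) simp
  next
    case (Cons e es)
    then obtain k where k: "prod_list es = (1 + c) ^ k"
      "sum_list es = of_nat (length es) + of_nat k * c" by auto
    have "e = 1 \<or> e = 1 + c" using Cons(2) by simp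
    then show ?case
    proof
      assume "e = 1"
      then show ?thesis using k by (intro exI[of _ k]) simp
    next
      assume "e = 1 + c"
      then show ?thesis using k by (intro exI[of _ "Suc k"]) (simp add: algebra_simps)
    qed
  qed
  then obtain k where k: "prod_list es = (1 + c) ^ k" "c = of_nat k * c"
    using assms(2) by auto
  show ?thesis
  proof (cases "c = 0")
    case False
    then have "of_nat k = (1 :: complex)" using k(2) by simp
    then have "k = 1" by (metis of_nat_1 of_nat_eq_iff)
    then show ?thesis using k by simp
  qed (use k in simp)
qed

text \<open>Every eigenvalue of \<open>1 + u h\<close> is \<open>1\<close> or \<open>1 + h u\<close>, and the trace fixes the multiplicities.\<close>

lemma cdet_rank_one:
  fixes u h :: "complex ^ 'n"
  shows "cdet (mat 1 + (\<chi> i j. u $ i * h $ j)) = 1 + (\<Sum>i\<in>UNIV. h $ i * u $ i)"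
proof -
  let ?U = "(\<chi> i j. u $ i * h $ j) :: complex ^ 'n ^ 'n"
  let ?X = "mat 1 + ?U"
  define c where "c = (\<Sum>i\<in>UNIV. h $ i * u $ i)"
  obtain es where es: "length es = CARD('n)" "cdet ?X = prod_list es" "trace ?X = sum_list es"
    "\<And>e. e \<in> set es \<Longrightarrow> \<exists>v. v \<noteq> 0 \<and> ?X *v v = e *s v"
    using eigenvalue_list[of ?X] by metis
  have "trace ?X = of_nat (CARD('n)) + c"
    by (simp add: trace_add trace_I) (simp add: trace_def c_def mult.commute)
  moreover have "e = 1 \<or> e = 1 + c" if e: "e \<in> set es" for e
  proof -
    obtain v where v: "v \<noteq> 0" "?X *v v = e *s v" using es(4)[OF e] by blast
    define d where "d = (\<Sum>i\<in>UNIV. h $ i * v $ i)"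
    have "?U *v v = d *s u"
      by (simp add: Finite_Cartesian_Product.vec_eq_iff matrix_vector_mult_def d_def
          sum_distrib_left sum_distrib_right mult_ac)
    then have eq: "v + d *s u = e *s v"
      using v(2) by (simp add: matrix_vector_mult_add_rdistrib)
    \<comment> \<open>Applying the row \<open>h\<close> to \<open>eq\<close> gives
      \<open>d + d * c = e * d\<close>; if \<open>d = 0\<close>, then \<open>eq\<close> itself says
      \<open>v = e *s v\<close>.\<close>
    have "(\<Sum>i\<in>UNIV. h $ i * (v + d *s u) $ i) = d + d * c"
      unfolding c_def by (subst (2) d_def) (simp add: ring_distribs sum.distrib sum_distrib_left mult_ac)
    moreover have "(\<Sum>i\<in>UNIV. h $ i * (e *s v) $ i) = e * d"
      unfolding d_def by (simp add: sum_distrib_left mult_ac)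
    ultimately have "d + d * c = e * d" unfolding eq by simp
    then have "d = 0 \<or> e = 1 + c" by (simp add: algebra_simps) (metis add.commute mult.commute
        mult_cancel_right distrib_right mult_1)
    moreover have "e = 1" if "d = 0"
    proof -
      have "1 *s v = e *s v" using eq that by simp
      then show ?thesis using v(1)
        by (metis (no_types, lifting) Finite_Cartesian_Product.vec_eq_iff mult_cancel_right
            vector_smult_component zero_index)
    qed
    ultimately show ?thesis by blast
  qed
  ultimately show ?thesis
    using prod_list_two_values[of es c] es(1-3) c_def by metis
qed

section \<open>Rank-one matrices, traces and inverse covariances\<close>

lemma sesq_add_mat: "sesq (A + B) x y = sesq A x y + sesq B x y"
  and sesq_diff_mat: "sesq (A - B) x y = sesq A x y - sesq B x y"
  and sesq_scale_mat: "sesq (c *\<^sub>R A) x y = of_real c * sesq A x y"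
  unfolding sesq_eq_sum
  by (simp_all add: ring_distribs sum.distrib sum_subtractf sum_distrib_left scaleR_conv_of_real[where 'a=complex] mult_ac)

lemma hermitian_iff: "hermitian A \<longleftrightarrow> (\<forall>i j. cnj (A $ j $ i) = A $ i $ j)"
  by (auto simp: hermitian_def conj_transpose_def Finite_Cartesian_Product.vec_eq_iff)

lemma hermitian_add: "hermitian A \<Longrightarrow> hermitian B \<Longrightarrow> hermitian (A + B)"
  and hermitian_diff: "hermitian A \<Longrightarrow> hermitian B \<Longrightarrow> hermitian (A - B)"
  and hermitian_scale: "hermitian A \<Longrightarrow> hermitian (c *\<^sub>R A)"
  by (simp_all add: hermitian_iff)

lemma hermitian_outer: "hermitian (outer z)"
  by (simp add: hermitian_iff outer_def mult.commute)

lemma sesq_outer: "sesq (outer z) x y = hdot x z * hdot z y"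
  by (simp add: sesq_eq_sum hdot_def outer_def sum_product mult_ac)

lemma sesq_outer_self: "sesq (outer z) x x = of_real ((cmod (hdot x z))\<^sup>2)"
  unfolding sesq_outer complex_norm_square by (metis hdot_commute)

lemma psdI: "hermitian A \<Longrightarrow> (\<And>x. 0 \<le> Re (sesq A x x)) \<Longrightarrow> psd A"
  by (simp add: psd_def herm_form_eq_sesq)

lemma psd_outer: "psd (outer z)"
  by (intro psdI hermitian_outer) (simp add: sesq_outer_self)

lemma trace_mult_eq_sum: "trace (A ** B) = (\<Sum>i\<in>UNIV. \<Sum>k\<in>UNIV. A $ i $ k * B $ k $ i)"
  by (simp add: trace_def matrix_matrix_mult_def)

lemma trace_mult_outer: "trace (A ** outer z) = sesq A z z"
  by (simp add: trace_mult_eq_sum sesq_eq_sum outer_def mult_ac)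

lemma trace_outer_mult: "trace (outer h ** Q) = sesq Q h h"
  unfolding trace_mult_eq_sum sesq_eq_sum
  by (subst sum.swap) (simp add: outer_def mult_ac)

lemma
  fixes A B Q :: "complex ^ 'n ^ 'n"
  shows trace_mult_add: "trace ((A + B) ** Q) = trace (A ** Q) + trace (B ** Q)"
  and trace_mult_diff: "trace ((A - B) ** Q) = trace (A ** Q) - trace (B ** Q)"
  and trace_mult_scale: "trace ((c *\<^sub>R A) ** Q) = of_real c * trace (A ** Q)"
  and trace_mult_diff_right: "trace (Q ** (A - B)) = trace (Q ** A) - trace (Q ** B)"
  and trace_mult_scale_right: "trace (Q ** (c *\<^sub>R A)) = of_real c * trace (Q ** A)"
  unfolding trace_mult_eq_sum
  by (simp_all add: ring_distribs sum.distrib sum_subtractf sum_distrib_left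
      scaleR_conv_of_real[where 'a=complex] mult_ac)

lemma conj_transpose_mult: "conj_transpose (A ** B) = conj_transpose B ** conj_transpose A"
  by (simp add: conj_transpose_def matrix_matrix_mult_def Finite_Cartesian_Product.vec_eq_iff mult.commute)

lemma hermitian_matrix_inv:
  fixes M :: "complex ^ 'n ^ 'n"
  assumes "posdef M"
  shows "hermitian (matrix_inv M)"
proof -
  let ?G = "matrix_inv M"
  have "conj_transpose (M ** ?G) = (mat 1 :: complex ^ 'n ^ 'n)"
    using posdef_inverse(2)[OF assms] posdef_mat_1[where 'n='n] by (simp add: posdef_def hermitian_def)
  then have "conj_transpose ?G ** M = mat 1"
    using assms by (simp add: conj_transpose_mult posdef_def hermitian_def)
  then have "conj_transpose ?G = ?G"
    using posdef_inverse(2)[OF assms]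
    by (metis matrix_mul_assoc matrix_mul_lid matrix_mul_rid)
  then show ?thesis by (simp add: hermitian_def)
qed

lemma vmm_assoc: "(x v* A) v* B = x v* (A ** B)"
  by (simp add: vector_matrix_mul_assoc)

text \<open>In the inner product given by \<open>M\<close>, the row \<open>h v* matrix_inv M\<close>
  represents the functional \<open>hdot x h\<close> of \<open>x\<close>, so Cauchy-Schwarz for
  \<open>M\<close> applies to that functional.\<close>

lemma sesq_matrix_inv:
  assumes "posdef M"
  shows "sesq M x (h v* matrix_inv M) = hdot x h"
proof -
  have "sesq M (h v* matrix_inv M) x = hdot h x"
    unfolding sesq_def vmm_assoc using posdef_inverse(1)[OF assms] by simp
  moreover have "hermitian M" using assms by (simp add: posdef_def)
  ultimately show ?thesis using sesq_hermitian hdot_commute by metis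
qed

lemma sesq_matrix_inv_self:
  assumes "posdef M"
  shows "sesq (matrix_inv M) h h = sesq M (h v* matrix_inv M) (h v* matrix_inv M)"
  unfolding sesq_matrix_inv[OF assms] by (simp add: sesq_def)

lemma sesq_matrix_inv_nonneg: "posdef M \<Longrightarrow> 0 \<le> Re (sesq (matrix_inv M) h h)"
  using sesq_matrix_inv_self psd_form_nonneg posdef_psd by metis

lemma sesq_matrix_inv_eq_0:
  assumes "posdef M" "Re (sesq (matrix_inv M) h h) = 0"
  shows "h = 0"
proof -
  have "h v* matrix_inv M = 0"
    using assms sesq_matrix_inv_self posdef_form_pos by (metis less_irrefl)
  then have "(h v* matrix_inv M) v* M = 0" by simp
  then show ?thesis
    unfolding vmm_assoc using posdef_inverse(1)[OF assms(1)] by simp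
qed

text \<open>With \<open>k = h M\<^sup>-\<^sup>1 h\<^sup>H\<close>, Cauchy-Schwarz for
  \<open>M\<close> makes \<open>k M - h\<^sup>H h\<close> psd, and its trace against the psd matrix
  \<open>Q\<close> is nonnegative.\<close>

lemma form_le_trace:
  assumes M: "posdef M" and Q: "psd Q"
  shows "Re (sesq Q h h) \<le> Re (sesq (matrix_inv M) h h) * Re (trace (M ** Q))"
proof -
  let ?k = "Re (sesq (matrix_inv M) h h)"
  let ?K = "?k *\<^sub>R M - outer h"
  have "psd ?K"
  proof (rule psdI)
    show "hermitian ?K"
      using M by (intro hermitian_diff hermitian_scale hermitian_outer) (simp add: posdef_def)
    fix x
    have "(cmod (sesq M x (h v* matrix_inv M)))\<^sup>2 \<le> Re (sesq M x x) * ?k"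
      unfolding sesq_matrix_inv_self[OF M] by (rule psd_Cauchy_Schwarz[OF posdef_psd[OF M]])
    then show "0 \<le> Re (sesq ?K x x)"
      by (simp add: sesq_diff_mat sesq_scale_mat sesq_outer_self sesq_matrix_inv[OF M] mult.commute)
  qed
  from trace_psd_mult_nonneg[OF this Q] show ?thesis
    by (simp add: trace_mult_diff trace_mult_scale trace_outer_mult)
qed

text \<open>Test the hypothesis on \<open>Q = z\<^sup>H z\<close> with
  \<open>z = h M\<^sup>-\<^sup>1\<close>: the two sides become \<open>\<mu> k\<^sup>2\<close> and
  \<open>k\<close>, where \<open>k = h M\<^sup>-\<^sup>1 h\<^sup>H\<close>.\<close>

lemma inverse_form_le:
  assumes M: "posdef M" and mu: "0 \<le> \<mu>"
    and le: "\<And>Q. psd Q \<Longrightarrow> \<mu> * Re (sesq Q h h) \<le> Re (trace (M ** Q))"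
  shows "\<mu> * Re (sesq (matrix_inv M) h h) \<le> 1"
proof -
  let ?k = "Re (sesq (matrix_inv M) h h)"
  let ?z = "h v* matrix_inv M"
  have "hdot h ?z = of_real ?k"
    using sesq_self_real[OF hermitian_matrix_inv[OF M], of h]
    by (metis complex_cnj_complex_of_real hdot_commute sesq_def)
  then have "\<mu> * ?k\<^sup>2 \<le> ?k"
    using le[OF psd_outer[of ?z]] by (simp add: trace_mult_outer sesq_outer_self sesq_matrix_inv_self[OF M, symmetric])
  moreover have "0 \<le> ?k" using sesq_matrix_inv_nonneg[OF M] .
  ultimately show ?thesis
    by (cases "?k = 0") (auto simp: power2_eq_square mult.assoc[symmetric])
qed

text \<open>Complementary slackness for the cone of psd matrices: subtracting a small multiple of
  \<open>Q x\<^sup>H x Q\<close> from \<open>Q\<close> stays in the cone, so a minimiser \<open>Q\<close> of the nonnegative functional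
  \<open>trace (K Q)\<close> with value \<open>0\<close> satisfies \<open>x Q K = 0\<close>.\<close>

lemma psd_trace_null:
  assumes K: "psd K" and Q: "psd Q" and null: "Re (trace (K ** Q)) = 0"
  shows "(x v* Q) v* K = 0"
proof (rule psd_null[OF K])
  let ?y = "x v* Q"
  \<comment> \<open>Small enough that \<open>e * Re (sesq Q x x) \<le> 1\<close>, as Cauchy-Schwarz
    requires below; adding one avoids a zero denominator.\<close>
  define e where "e = 1 / (Re (sesq Q x x) + 1)"
  have f: "0 \<le> Re (sesq Q x x)" using psd_form_nonneg[OF Q] .
  then have e: "0 < e" "e * Re (sesq Q x x) \<le> 1" by (simp_all add: e_def field_simps)
  have "psd (Q - e *\<^sub>R outer ?y)"
  proof (rule psdI)
    show "hermitian (Q - e *\<^sub>R outer ?y)"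
      using Q by (intro hermitian_diff hermitian_scale hermitian_outer psd_hermitian)
    fix z
    have "hdot z ?y = cnj (sesq Q x z)" by (metis hdot_commute sesq_def)
    then have "e * (cmod (hdot z ?y))\<^sup>2 \<le> e * (Re (sesq Q x x) * Re (sesq Q z z))"
      using psd_Cauchy_Schwarz[OF Q, of x z] e(1) by simp
    also have "\<dots> \<le> 1 * Re (sesq Q z z)"
      unfolding mult.assoc[symmetric] using e psd_form_nonneg[OF Q] by (intro mult_right_mono) auto
    finally show "0 \<le> Re (sesq (Q - e *\<^sub>R outer ?y) z z)"
      by (simp add: sesq_diff_mat sesq_scale_mat sesq_outer_self)
  qed
  from trace_psd_mult_nonneg[OF K this] have "e * Re (sesq K ?y ?y) \<le> 0"
    using null by (simp add: trace_mult_diff_right trace_mult_scale_right trace_mult_outer)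
  then show "Re (sesq K ?y ?y) = 0"
    using e(1) psd_form_nonneg[OF K, of ?y] by (simp add: mult_le_0_iff)
qed

text \<open>Equality makes \<open>Q\<close> complementary to \<open>M - \<mu> h\<^sup>H h\<close>,
  so \<open>Q = \<mu> Q h\<^sup>H h M\<^sup>-\<^sup>1\<close>. This identity and its adjoint make
  \<open>Q\<close> a multiple of the rank-one matrix
  \<open>M\<^sup>-\<^sup>1 h\<^sup>H h M\<^sup>-\<^sup>1\<close>.\<close>

lemma form_at_equality:
  assumes M: "posdef M"
    and le: "\<And>Q. psd Q \<Longrightarrow> \<mu> * Re (sesq Q h h) \<le> Re (trace (M ** Q))"
    and Q: "psd Q" and eq: "\<mu> * Re (sesq Q h h) = Re (trace (M ** Q))"
  shows "Re (sesq Q x x) = \<mu>\<^sup>2 * (cmod (sesq (matrix_inv M) h x))\<^sup>2 * Re (sesq Q h h)"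
proof -
  let ?K = "M - \<mu> *\<^sub>R outer h"
  let ?G = "matrix_inv M"
  have "psd ?K"
  proof (rule psdI)
    show "hermitian ?K"
      using M by (intro hermitian_diff hermitian_scale hermitian_outer) (simp add: posdef_def)
    fix z
    show "0 \<le> Re (sesq ?K z z)"
      using le[OF psd_outer[of z]]
      by (simp add: sesq_diff_mat sesq_scale_mat trace_mult_outer sesq_outer_self)
        (metis complex_mod_cnj hdot_commute)
  qed
  moreover have "Re (trace (?K ** Q)) = 0"
    using eq by (simp add: trace_mult_diff trace_mult_scale trace_outer_mult)
  ultimately have null: "(y v* Q) v* ?K = 0" for y
    using psd_trace_null[OF _ Q] by blast
  have eq2: "sesq Q y z = of_real \<mu> * sesq Q y h * sesq ?G h z" for y z
  proof -
    let ?w = "z v* ?G"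
    have "sesq ?K (y v* Q) ?w = 0"
      unfolding sesq_def null by (simp add: hdot_def)
    then have "sesq M (y v* Q) ?w = of_real \<mu> * (hdot (y v* Q) h * hdot h ?w)"
      by (simp add: sesq_diff_mat sesq_scale_mat sesq_outer)
    moreover have "hdot h ?w = sesq ?G h z"
      using sesq_hermitian[OF hermitian_matrix_inv[OF M], of h z] by (metis hdot_commute sesq_def)
    ultimately show ?thesis
      unfolding sesq_matrix_inv[OF M] by (simp add: sesq_def)
  qed
  have "sesq Q x h = cnj (of_real \<mu> * sesq Q h h * sesq ?G h x)"
    using sesq_hermitian[OF psd_hermitian[OF Q], of h x] eq2[of h x] by simp
  also have "\<dots> = of_real \<mu> * sesq Q h h * cnj (sesq ?G h x)"
    using sesq_self_real[OF psd_hermitian[OF Q], of h] by (metis complex_cnj_complex_of_real complex_cnj_mult)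
  finally have "sesq Q x x = of_real (\<mu>\<^sup>2) * (sesq ?G h x * cnj (sesq ?G h x)) * sesq Q h h"
    using eq2[of x x] by (simp add: power2_eq_square mult_ac)
  also have "\<dots> = of_real (\<mu>\<^sup>2 * (cmod (sesq ?G h x))\<^sup>2 * Re (sesq Q h h))"
    unfolding complex_norm_square[symmetric]
    by (subst sesq_self_real[OF psd_hermitian[OF Q], of h, symmetric]) simp
  finally show ?thesis by simp
qed

text \<open>Factor the update as \<open>M (1 + q M\<^sup>-\<^sup>1 h\<^sup>H h)\<close> and use the
  determinant of a rank-one perturbation of the identity. Its positivity comes from the two positive
  determinants, whatever the sign of \<open>q\<close>.\<close>

lemma logdet_rank_one_update:
  assumes M: "posdef M" and M': "posdef (M + q *\<^sub>R outer h)"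
  shows "logdet (M + q *\<^sub>R outer h) = logdet M + ln (1 + q * Re (sesq (matrix_inv M) h h))"
    "0 < 1 + q * Re (sesq (matrix_inv M) h h)"
proof -
  let ?G = "matrix_inv M" and ?M' = "M + q *\<^sub>R outer h"
  define u where "u = (\<chi> i. of_real q * (\<Sum>k\<in>UNIV. ?G $ i $ k * cnj (h $ k)))"
  have "?G ** (q *\<^sub>R outer h) = (\<chi> i j. u $ i * h $ j)"
    by (simp add: Finite_Cartesian_Product.vec_eq_iff matrix_matrix_mult_def outer_def u_def
        sum_distrib_left sum_distrib_right scaleR_conv_of_real[where 'a=complex] mult_ac)
  then have "?G ** ?M' = mat 1 + (\<chi> i j. u $ i * h $ j)"
    using posdef_inverse(1)[OF M] by (simp add: matrix_add_ldistrib)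
  then have "cdet ?G * cdet ?M' = 1 + (\<Sum>i\<in>UNIV. h $ i * u $ i)"
    using cdet_mult[of ?G ?M'] cdet_rank_one[of u h] by simp
  also have "(\<Sum>i\<in>UNIV. h $ i * u $ i) = of_real q * sesq ?G h h"
    by (simp add: u_def sesq_eq_sum sum_distrib_left mult_ac)
  also have "\<dots> = of_real (q * Re (sesq ?G h h))"
    using sesq_self_real[OF hermitian_matrix_inv[OF M], of h] by simp
  finally have 1: "cdet ?G * cdet ?M' = of_real (1 + q * Re (sesq ?G h h))" by simp
  have "cdet ?G * cdet M = 1"
    using posdef_inverse(1)[OF M] cdet_mult cdet_mat_1 by metis
  then have "cdet ?M' = cdet M * (cdet ?G * cdet ?M')"
    by (metis mult.assoc mult.commute mult_1)
  then have "cdet ?M' = cdet M * of_real (1 + q * Re (sesq ?G h h))"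
    unfolding 1 .
  then have 2: "Re (cdet ?M') = Re (cdet M) * (1 + q * Re (sesq ?G h h))"
    using posdef_cdet(1)[OF M] by (metis Re_complex_of_real of_real_mult)
  then show pos: "0 < 1 + q * Re (sesq ?G h h)"
    using posdef_cdet(2)[OF M] posdef_cdet(2)[OF M'] by (simp add: zero_less_mult_iff)
  show "logdet ?M' = logdet M + ln (1 + q * Re (sesq ?G h h))"
    unfolding logdet_def 2 using posdef_cdet(2)[OF M] pos by (simp add: ln_mult_pos)
qed

text \<open>Sherman--Morrison, in the form \<open>G\<^sub>0 - G\<^sub>1 = q G\<^sub>0 h\<^sup>H h G\<^sub>0 / (1 + q h G\<^sub>0 h\<^sup>H)\<close>.\<close>

lemma form_inverse_rank_one_update:
  assumes M: "posdef M" and M': "posdef (M + q *\<^sub>R outer h)"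
  defines "G \<equiv> matrix_inv M"
  shows "Re (sesq G x x) - Re (sesq (matrix_inv (M + q *\<^sub>R outer h)) x x)
    = q * (cmod (sesq G h x))\<^sup>2 / (1 + q * Re (sesq G h h))"
proof -
  let ?M' = "M + q *\<^sub>R outer h"
  define k where "k = Re (sesq G h h)"
  \<comment> \<open>The vector \<open>y\<close> below is the candidate for
    \<open>x v* matrix_inv ?M'\<close>. It must solve \<open>y M + q (y h\<^sup>H) h = x\<close>,
    and \<open>c\<close> is the value of \<open>q (y h\<^sup>H)\<close> that this forces.\<close>
  define c where "c = of_real q * sesq G x h / of_real (1 + q * k)"
  define y where "y = x v* G - c *s (h v* G)"
  have pos: "0 < 1 + q * k" unfolding k_def G_def by (rule logdet_rank_one_update(2)[OF M M'])
  have GM: "(z v* G) v* M = z" for z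
    unfolding vmm_assoc G_def using posdef_inverse(1)[OF M] by simp
  have k: "sesq G h h = of_real k"
    unfolding k_def G_def using sesq_self_real[OF hermitian_matrix_inv[OF M], of h] by simp
  have "hdot y h = sesq G x h - c * of_real k"
    by (simp add: y_def hdot_diff_left hdot_scale_left sesq_def[symmetric] k)
  also have "of_real q * \<dots> = c"
    proof -
    have "complex_of_real (1 + q * k) \<noteq> 0" using pos by (metis less_irrefl of_real_eq_0_iff)
    then show ?thesis unfolding c_def by (simp add: field_simps)
  qed
  finally have qc: "of_real q * hdot y h = c" .
  have "y v* ?M' = x"
  proof -
    have "hdot (y v* ?M') z = hdot x z" for z
    proof -
      have "hdot (y v* ?M') z = hdot (y v* M) z + of_real q * hdot y h * hdot h z"
        unfolding sesq_def[symmetric] by (simp add: sesq_add_mat sesq_scale_mat sesq_outer)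
      also have "hdot (y v* M) z = hdot x z - c * hdot h z"
        unfolding sesq_def[symmetric] y_def sesq_diff_left sesq_scale_left
        by (simp add: sesq_def GM)
      finally show ?thesis unfolding qc by simp
    qed
    then show ?thesis using eq_0_if_hdot[of "y v* ?M' - x"] by (simp add: hdot_diff_left)
  qed
  then have "x v* matrix_inv ?M' = y"
    using posdef_inverse(2)[OF M'] by (metis vmm_assoc vector_matrix_mul_rid)
  then have "sesq (matrix_inv ?M') x x = sesq G x x - c * sesq G h x"
    by (simp add: sesq_def y_def hdot_diff_left hdot_scale_left)
  moreover have "c * sesq G h x = of_real (q * (cmod (sesq G h x))\<^sup>2 / (1 + q * k))"
  proof -
    have "sesq G x h = cnj (sesq G h x)"
      unfolding G_def by (rule sesq_hermitian[OF hermitian_matrix_inv[OF M]])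
    then have "c * sesq G h x = of_real q * (sesq G h x * cnj (sesq G h x)) / of_real (1 + q * k)"
      by (simp add: c_def mult_ac)
    then show ?thesis unfolding complex_norm_square[symmetric] by simp
  qed
  ultimately show ?thesis unfolding k_def[symmetric] by simp
qed

section \<open>The dual multiple access channel\<close>

lemma posdef_add_outer:
  assumes "posdef M" "0 \<le> q"
  shows "posdef (M + q *\<^sub>R outer h)"
  unfolding posdef_def herm_form_eq_sesq
proof (intro conjI allI impI)
  show "hermitian (M + q *\<^sub>R outer h)"
    using assms by (intro hermitian_add hermitian_scale hermitian_outer) (simp add: posdef_def)
  fix x :: "complex ^ 'a" assume "x \<noteq> 0"
  then have "0 < Re (sesq M x x)" using assms(1) by (rule posdef_form_pos[rotated])
  then show "0 < Re (sesq (M + q *\<^sub>R outer h) x x)"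
    using assms(2) by (simp add: sesq_add_mat sesq_scale_mat sesq_outer_self add_pos_nonneg)
qed

lemma sesq_diag_mat: "sesq (diag_mat d) x x = of_real (\<Sum>i\<in>UNIV. d $ i * (cmod (x $ i))\<^sup>2)"
proof -
  have "(\<Sum>j\<in>UNIV. x $ i * diag_mat d $ i $ j * cnj (x $ j)) = of_real (d $ i * (cmod (x $ i))\<^sup>2)" for i
  proof -
    have "(\<Sum>j\<in>UNIV. x $ i * diag_mat d $ i $ j * cnj (x $ j))
        = (\<Sum>j\<in>UNIV. if j = i then of_real (d $ i) * (x $ i * cnj (x $ i)) else 0)"
      by (intro sum.cong) (auto simp: diag_mat_def)
    then show ?thesis by (simp add: complex_norm_square[symmetric])
  qed
  then show ?thesis unfolding sesq_eq_sum by simp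
qed

lemma posdef_diag_mat:
  assumes "\<And>l. 0 < d $ l"
  shows "posdef (diag_mat d)"
  unfolding posdef_def herm_form_eq_sesq sesq_diag_mat
proof (intro conjI allI impI)
  show "hermitian (diag_mat d)" by (auto simp: hermitian_iff diag_mat_def)
  fix x :: "complex ^ 'a" assume "x \<noteq> 0"
  then obtain i where "x $ i \<noteq> 0" by (auto simp: Finite_Cartesian_Product.vec_eq_iff)
  then have "0 < (\<Sum>i\<in>UNIV. d $ i * (cmod (x $ i))\<^sup>2)"
    using assms by (intro sum_pos2[of UNIV i]) (auto simp: less_imp_le)
  then show "0 < Re (of_real (\<Sum>i\<in>UNIV. d $ i * (cmod (x $ i))\<^sup>2))" by simp
qed

text \<open>Covariance of the signal received in the dual multiple access channel from users
  \<open>1, \<dots>, j\<close> with powers \<open>q\<close>, where the noise has covariance \<open>diag_mat lam\<close>.\<close>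

definition mac_cov :: "real ^ 'n \<Rightarrow> (nat \<Rightarrow> complex ^ 'n) \<Rightarrow> (nat \<Rightarrow> real) \<Rightarrow> nat \<Rightarrow> complex ^ 'n ^ 'n" where
  "mac_cov lam h q j = diag_mat lam + (\<Sum>m=1..j. q m *\<^sub>R outer (h m))"

lemma mac_cov_0: "mac_cov lam h q 0 = diag_mat lam"
  by (simp add: mac_cov_def)

lemma mac_cov_Suc: "mac_cov lam h q (Suc j) = mac_cov lam h q j + q (Suc j) *\<^sub>R outer (h (Suc j))"
  by (simp add: mac_cov_def)

lemma mac_cov_pred:
  assumes "1 \<le> j"
  shows "mac_cov lam h q j = mac_cov lam h q (j - 1) + q j *\<^sub>R outer (h j)"
  using mac_cov_Suc[of lam h q "j - 1"] assms by simp

lemma mac_cov_cong: "(\<And>m. m \<in> {1..j} \<Longrightarrow> q m = q' m) \<Longrightarrow> mac_cov lam h q j = mac_cov lam h q' j"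
  by (simp add: mac_cov_def)

lemma posdef_mac_cov:
  assumes "\<And>l. 0 < lam $ l" "\<And>m. m \<in> {1..j} \<Longrightarrow> 0 \<le> q m"
  shows "posdef (mac_cov lam h q j)"
  using assms(2)
proof (induct j)
  case 0
  then show ?case unfolding mac_cov_0 by (intro posdef_diag_mat assms(1))
next
  case (Suc j)
  then show ?case unfolding mac_cov_Suc by (intro posdef_add_outer) auto
qed

lemma trace_mac_cov:
  "Re (trace (mac_cov lam h q j ** Q))
    = Re (trace (diag_mat lam ** Q)) + (\<Sum>m=1..j. q m * Re (sesq Q (h m) (h m)))"
  by (induct j) (simp_all add: mac_cov_0 mac_cov_Suc trace_mult_add trace_mult_scale trace_outer_mult)

lemma trace_mult_mac_cov:
  "Re (trace (G ** mac_cov lam h q j)) - Re (trace (G ** mac_cov lam h q' j))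
    = (\<Sum>m=1..j. (q m - q' m) * Re (sesq G (h m) (h m)))"
proof (induct j)
  case (Suc j)
  have "trace (G ** (A + B)) = trace (G ** A) + trace (G ** B)" for A B
    by (simp add: matrix_add_ldistrib trace_add)
  then show ?case
    using Suc by (simp add: mac_cov_Suc trace_mult_scale_right trace_mult_outer algebra_simps)
qed (simp add: mac_cov_0)

lemma sum_triangle_swap:
  fixes g :: "nat \<Rightarrow> nat \<Rightarrow> real"
  shows "(\<Sum>j=1..N. \<Sum>k=j+1..N. g j k) = (\<Sum>k=1..N. \<Sum>j=1..k-1. g j k)"
proof -
  have "(\<Sum>j=1..N. \<Sum>k=j+1..N. g j k) = (\<Sum>j\<in>{1..N}. \<Sum>k | k \<in> {1..N} \<and> j < k. g j k)"
    by (intro sum.cong) auto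
  also have "\<dots> = (\<Sum>k\<in>{1..N}. \<Sum>j | j \<in> {1..N} \<and> j < k. g j k)"
    by (rule sum.swap_restrict) auto
  also have "\<dots> = (\<Sum>k=1..N. \<Sum>j=1..k-1. g j k)"
    by (intro sum.cong) auto
  finally show ?thesis .
qed

text \<open>Total power in the multiple access channel: \<open>f j k\<close> is the power received by user \<open>j\<close>
  from the signal of user \<open>k\<close> in the broadcast channel, and \<open>a j\<close> the interference.\<close>

lemma mac_power_sum:
  fixes f :: "nat \<Rightarrow> nat \<Rightarrow> real"
  assumes "\<And>j. j \<in> {1..N} \<Longrightarrow> a j = 1 + (\<Sum>k=j+1..N. f j k)" "\<And>j. j \<in> {1..N} \<Longrightarrow> 0 < a j"
    and "\<And>j. j \<in> {1..N} \<Longrightarrow> q j = \<mu> j * (f j j / a j)"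
  shows "(\<Sum>j=1..N. q j) = (\<Sum>k=1..N. \<mu> k * f k k - (\<Sum>j=1..k-1. q j * f j k))"
proof -
  have "q j = \<mu> j * f j j - (\<Sum>k=j+1..N. q j * f j k)" if j: "j \<in> {1..N}" for j
  proof -
    have "\<mu> j * f j j = q j * a j" using assms(2,3)[OF j] by simp
    also have "\<dots> = q j + (\<Sum>k=j+1..N. q j * f j k)"
      unfolding assms(1)[OF j] by (simp add: ring_distribs sum_distrib_left)
    finally show ?thesis by simp
  qed
  then have "(\<Sum>j=1..N. q j) = (\<Sum>j=1..N. \<mu> j * f j j - (\<Sum>k=j+1..N. q j * f j k))"
    by (rule sum.cong[OF refl])
  then show ?thesis unfolding sum_subtractf sum_triangle_swap .
qed

text \<open>The denominator at \<open>j\<close> involves only powers before \<open>j\<close>, so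
  they are found one after another; \<open>\<gamma> j\<close> is the prescribed
  signal-to-interference ratio. A vanishing denominator means \<open>h j = 0\<close> and yields
  power zero.\<close>

lemma mac_powers_exist:
  fixes \<gamma> :: "nat \<Rightarrow> real"
  assumes lam: "\<And>l. 0 < lam $ l" and \<gamma>: "\<And>j. 0 \<le> \<gamma> j"
  shows "\<exists>q. (\<forall>j. 0 \<le> q j) \<and> (\<forall>j\<in>{1..n}. q j =
    \<gamma> j / Re (sesq (matrix_inv (mac_cov lam h q (j - 1))) (h j) (h j)))"
proof (induct n)
  case 0
  show ?case by (intro exI[of _ "\<lambda>_. 0"]) simp
next
  case (Suc n)
  then obtain q where q: "\<And>j. 0 \<le> q j" "\<And>j. j \<in> {1..n} \<Longrightarrow> q j =
    \<gamma> j / Re (sesq (matrix_inv (mac_cov lam h q (j - 1))) (h j) (h j))" by blast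
  define q' where "q' = q(Suc n := \<gamma> (Suc n) / Re (sesq (matrix_inv (mac_cov lam h q n)) (h (Suc n)) (h (Suc n))))"
  have eq: "mac_cov lam h q' (j - 1) = mac_cov lam h q (j - 1)" if "j \<in> {1..Suc n}" for j
    using that by (intro mac_cov_cong) (auto simp: q'_def)
  have "0 \<le> q' j" for j
    using q(1) \<gamma> sesq_matrix_inv_nonneg[OF posdef_mac_cov[OF lam q(1)]] by (simp add: q'_def)
  moreover have "q' j = \<gamma> j / Re (sesq (matrix_inv (mac_cov lam h q' (j - 1))) (h j) (h j))"
    if j: "j \<in> {1..Suc n}" for j
    unfolding eq[OF j] using q(2)[of j] j by (cases "j = Suc n") (auto simp: q'_def)
  ultimately show ?case by blast
qed

lemma logdet_mac_cov_step:
  assumes "\<And>l. 0 < lam $ l" "\<And>m. 0 \<le> q m" "1 \<le> j"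
  shows "logdet (mac_cov lam h q j) - logdet (mac_cov lam h q (j - 1))
    = ln (1 + q j * Re (sesq (matrix_inv (mac_cov lam h q (j - 1))) (h j) (h j)))"
proof -
  have M: "posdef (mac_cov lam h q m)" for m by (rule posdef_mac_cov[OF assms(1,2)])
  show ?thesis
    using logdet_rank_one_update(1)[OF M, of "j - 1" "q j" "h j"] M[of j]
    unfolding mac_cov_pred[OF assms(3)] by simp
qed

text \<open>Match the rates user by user. By \<open>form_le_trace\<close>, the quantity
  \<open>f k k / \<kappa> k\<close> is at most the trace of \<open>Q k\<close> against
  \<open>mac_cov lam h q (k - 1)\<close>, which exceeds the cost at \<open>lam\<close> by the terms
  \<open>q j * f j k\<close> with \<open>j < k\<close>. By \<open>mac_power_sum\<close> these are
  exactly the terms that the total power subtracts.\<close>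

lemma broadcast_to_mac:
  fixes Q :: "nat \<Rightarrow> complex ^ 'n ^ 'n"
  assumes lam: "\<And>l. 0 < lam $ l" and Q: "\<And>j. j \<in> {1..N} \<Longrightarrow> psd (Q j)"
    and a: "\<And>j. j \<in> {1..N} \<Longrightarrow> a j = 1 + (\<Sum>k=j+1..N. Re (sesq (Q k) (h j) (h j)))"
  obtains q where "\<And>j. 0 \<le> q j" "(\<Sum>j=1..N. q j) \<le> (\<Sum>j=1..N. Re (trace (diag_mat lam ** Q j)))"
    "\<And>j. j \<in> {1..N} \<Longrightarrow> ln (1 + Re (sesq (Q j) (h j) (h j)) / a j)
      = logdet (mac_cov lam h q j) - logdet (mac_cov lam h q (j - 1))"
proof -
  define f where "f j k = Re (sesq (Q k) (h j) (h j))" for j k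
  have f: "0 \<le> f j k" if "k \<in> {1..N}" for j k
    unfolding f_def using psd_form_nonneg Q that by blast
  have a1: "a j = 1 + (\<Sum>k=j+1..N. f j k)" if "j \<in> {1..N}" for j
    using a[OF that] by (simp add: f_def)
  have apos: "0 < a j" if "j \<in> {1..N}" for j
    unfolding a1[OF that] using f by (intro add_pos_nonneg sum_nonneg) auto
  define \<gamma> where "\<gamma> j = (if j \<in> {1..N} then f j j / a j else 0)" for j
  have \<gamma>: "0 \<le> \<gamma> j" for j using f apos by (simp add: \<gamma>_def less_imp_le)
  obtain q where q: "\<And>j. 0 \<le> q j" "\<And>j. j \<in> {1..N} \<Longrightarrow> q j =
    \<gamma> j / Re (sesq (matrix_inv (mac_cov lam h q (j - 1))) (h j) (h j))"
    using mac_powers_exist[where \<gamma>=\<gamma> and h=h and n=N, OF lam \<gamma>] by blast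
  define \<kappa> where "\<kappa> j = Re (sesq (matrix_inv (mac_cov lam h q (j - 1))) (h j) (h j))" for j
  have M: "posdef (mac_cov lam h q j)" for j by (rule posdef_mac_cov[OF lam q(1)])
  have qk: "q j * \<kappa> j = f j j / a j" if j: "j \<in> {1..N}" for j
  proof (cases "\<kappa> j = 0")
    case True
    then have "h j = 0" using sesq_matrix_inv_eq_0[OF M] unfolding \<kappa>_def by blast
    then have "f j j = 0" by (simp add: f_def sesq_eq_sum)
    then show ?thesis using True by simp
  next
    case False
    then show ?thesis using q(2)[OF j, folded \<kappa>_def] j by (simp add: \<gamma>_def)
  qed
  have "(\<Sum>j=1..N. q j) = (\<Sum>k=1..N. (1 / \<kappa> k) * f k k - (\<Sum>j=1..k-1. q j * f j k))"
  proof (rule mac_power_sum[OF a1 apos])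
    fix j assume "j \<in> {1..N}"
    then show "q j = 1 / \<kappa> j * (f j j / a j)"
      using q(2)[of j, folded \<kappa>_def] by (simp add: \<gamma>_def)
  qed auto
  also have "\<dots> \<le> (\<Sum>k=1..N. Re (trace (diag_mat lam ** Q k)))"
  proof (rule sum_mono)
    fix k assume k: "k \<in> {1..N}"
    have "(1 / \<kappa> k) * f k k \<le> Re (trace (mac_cov lam h q (k - 1) ** Q k))"
    proof (cases "\<kappa> k = 0")
      case True
      then show ?thesis using trace_psd_mult_nonneg[OF posdef_psd[OF M] Q[OF k]] by simp
    next
      case False
      then have "0 < \<kappa> k" using sesq_matrix_inv_nonneg[OF M] unfolding \<kappa>_def by (metis less_eq_real_def)
      then show ?thesis
        using form_le_trace[OF M Q[OF k], of "h k" "k - 1", folded \<kappa>_def]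
        by (simp add: f_def field_simps)
    qed
    then show "(1 / \<kappa> k) * f k k - (\<Sum>j=1..k-1. q j * f j k) \<le> Re (trace (diag_mat lam ** Q k))"
      unfolding trace_mac_cov f_def by simp
  qed
  finally have sum: "(\<Sum>j=1..N. q j) \<le> (\<Sum>j=1..N. Re (trace (diag_mat lam ** Q j)))" .
  have "ln (1 + Re (sesq (Q j) (h j) (h j)) / a j)
      = logdet (mac_cov lam h q j) - logdet (mac_cov lam h q (j - 1))" if j: "j \<in> {1..N}" for j
    using logdet_mac_cov_step[OF lam q(1), where j=j and h=h] j qk[OF j] by (simp add: \<kappa>_def f_def)
  from that[OF q(1) sum this] show ?thesis .
qed

lemma sum_by_parts_from_0:
  fixes W x :: "nat \<Rightarrow> real"
  shows "(\<Sum>j=1..n. W j * (x j - x (j - 1)))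
    = (\<Sum>j=1..n. (W j - W (Suc j)) * (x j - x 0)) + W (Suc n) * (x n - x 0)"
  by (induct n) (simp_all add: algebra_simps)

text \<open>Abel summation over the users encoded after \<open>k\<close>; it later converts the
  interference at \<open>k\<close> into derivatives of log-determinants.\<close>

lemma sum_by_parts_tail:
  fixes W y :: "nat \<Rightarrow> real"
  assumes "k \<le> n"
  shows "(\<Sum>j=k+1..n. W j * (y (j - 1) - y j)) + (\<Sum>j=k..n. (W j - W (Suc j)) * y j)
    = W k * y k - W (Suc n) * y n"
  using assms
proof (induct n rule: dec_induct)
  case base
  show ?case by (simp add: algebra_simps)
next
  case (step n)
  then show ?case by (simp add: algebra_simps)
qed

section \<open>Stationary points are global maximisers\<close>

text \<open>The hypotheses \<open>kkt_le\<close> and \<open>kkt_eq\<close> say that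
  \<open>M\<^sub>j\<^sub>-\<^sub>1 - \<mu>\<^sub>j h\<^sub>j\<^sup>H h\<^sub>j\<close> has
  nonnegative trace against every psd matrix and zero trace against \<open>Q j\<close>, which fixes
  the form of \<open>Q j\<close>. A competitor \<open>Q'\<close> is compared through its powers,
  using tangents of the log-determinants at the powers of \<open>Q\<close>.\<close>

lemma broadcast_kkt_global_max:
  fixes Q Q' :: "nat \<Rightarrow> complex ^ 'n ^ 'n" and h :: "nat \<Rightarrow> complex ^ 'n"
    and lam :: "real ^ 'n" and w a b :: "nat \<Rightarrow> real" and N :: nat
  defines "\<mu> \<equiv> \<lambda>j. w j / b j" and "q \<equiv> \<lambda>j. w j * (1 / a j - 1 / b j)"
  assumes lam: "\<And>l. 0 < lam $ l"
    and w_nonneg: "\<And>j. j \<in> {1..N} \<Longrightarrow> 0 \<le> w j"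
    and w_mono: "\<And>j. 1 \<le> j \<Longrightarrow> j < N \<Longrightarrow> w (Suc j) \<le> w j"
    and Q: "\<And>j. j \<in> {1..N} \<Longrightarrow> psd (Q j)"
    and a: "\<And>j. j \<in> {1..N} \<Longrightarrow> a j = 1 + (\<Sum>k=j+1..N. Re (sesq (Q k) (h j) (h j)))"
    and b: "\<And>j. j \<in> {1..N} \<Longrightarrow> b j = a j + Re (sesq (Q j) (h j) (h j))"
    and kkt_le: "\<And>j X. j \<in> {1..N} \<Longrightarrow> psd X \<Longrightarrow>
      \<mu> j * Re (sesq X (h j) (h j)) \<le> Re (trace (diag_mat lam ** X)) + (\<Sum>m=1..j-1. q m * Re (sesq X (h m) (h m)))"
    and kkt_eq: "\<And>j. j \<in> {1..N} \<Longrightarrow>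
      \<mu> j * Re (sesq (Q j) (h j) (h j))
        = Re (trace (diag_mat lam ** Q j)) + (\<Sum>m=1..j-1. q m * Re (sesq (Q j) (h m) (h m)))"
    and Q': "\<And>j. j \<in> {1..N} \<Longrightarrow> psd (Q' j)"
    and a': "\<And>j. j \<in> {1..N} \<Longrightarrow> a' j = 1 + (\<Sum>k=j+1..N. Re (sesq (Q' k) (h j) (h j)))"
  shows "(\<Sum>j=1..N. w j * ln (1 + Re (sesq (Q' j) (h j) (h j)) / a' j))
      - (\<Sum>j=1..N. Re (trace (diag_mat lam ** Q' j)))
    \<le> (\<Sum>j=1..N. w j * ln (1 + Re (sesq (Q j) (h j) (h j)) / a j))
      - (\<Sum>j=1..N. Re (trace (diag_mat lam ** Q j)))"
proof -
  define f where "f j k = Re (sesq (Q k) (h j) (h j))" for j k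
  have f: "0 \<le> f j k" if "k \<in> {1..N}" for j k
    unfolding f_def using psd_form_nonneg Q that by blast
  have a1: "a j = 1 + (\<Sum>k=j+1..N. f j k)" and b1: "b j = a j + f j j" if "j \<in> {1..N}" for j
    using a[OF that] b[OF that] by (simp_all add: f_def)
  have apos: "0 < a j" if "j \<in> {1..N}" for j
    unfolding a1[OF that] using f by (intro add_pos_nonneg sum_nonneg) auto
  have bpos: "0 < b j" if "j \<in> {1..N}" for j
    using b1[OF that] apos[OF that] f[OF that, of j] by simp
  have \<mu>: "0 \<le> \<mu> j" if "j \<in> {1..N}" for j
    using w_nonneg[OF that] bpos[OF that] by (simp add: \<mu>_def)
  have q_eq: "q j = \<mu> j * (f j j / a j)" if "j \<in> {1..N}" for j
    using apos[OF that] bpos[OF that] b1[OF that]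
    by (simp add: q_def \<mu>_def diff_frac_eq)
  \<comment> \<open>Outside the user range nothing is known about the sign of \<open>q\<close>;
    cutting it off makes every \<open>M j\<close> positive definite.\<close>
  define p where "p j = (if j \<in> {1..N} then q j else 0)" for j
  have p: "0 \<le> p j" for j
    using q_eq \<mu> f apos by (simp add: p_def less_imp_le)
  define M where "M = mac_cov lam h p"
  have M: "posdef (M j)" for j unfolding M_def by (rule posdef_mac_cov[OF lam p])
  have M_pred: "M j = M (j - 1) + p j *\<^sub>R outer (h j)" if "1 \<le> j" for j
    unfolding M_def by (rule mac_cov_pred[OF that])
  have pq: "(\<Sum>m=1..j-1. q m * g m) = (\<Sum>m=1..j-1. p m * g m)" if "j \<in> {1..N}" for j g
    using that by (intro sum.cong) (auto simp: p_def)
  have le: "\<mu> j * Re (sesq X (h j) (h j)) \<le> Re (trace (M (j - 1) ** X))"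
    if "j \<in> {1..N}" "psd X" for j X
    using kkt_le[OF that] unfolding M_def trace_mac_cov pq[OF that(1)] .
  have eq: "\<mu> j * f j j = Re (trace (M (j - 1) ** Q j))" if "j \<in> {1..N}" for j
    using kkt_eq[OF that] unfolding M_def trace_mac_cov pq[OF that] f_def .

  define g where "g j x = Re (sesq (matrix_inv (M j)) x x)" for j x
  define \<kappa> where "\<kappa> j = g (j - 1) (h j)" for j
  have \<kappa>_nonneg: "0 \<le> \<kappa> j" for j unfolding \<kappa>_def g_def by (rule sesq_matrix_inv_nonneg[OF M])
  have cmod_\<kappa>: "cmod (sesq (matrix_inv (M (j - 1))) (h j) (h j)) = \<kappa> j" for j
    using sesq_self_real[OF hermitian_matrix_inv[OF M], of "j - 1" "h j"] \<kappa>_nonneg[of j]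
    unfolding \<kappa>_def g_def by (metis abs_of_nonneg norm_of_real)
  have g_diff: "g (j - 1) x - g j x
      = p j * (cmod (sesq (matrix_inv (M (j - 1))) (h j) x))\<^sup>2 / (1 + p j * \<kappa> j)" if "1 \<le> j" for j x
    using form_inverse_rank_one_update[OF M[of "j - 1"], of "p j" "h j" x] M[of j]
    unfolding M_pred[OF that, symmetric] g_def \<kappa>_def by simp
  have f_eq: "Re (sesq (Q j) x x) = (\<mu> j)\<^sup>2 * (cmod (sesq (matrix_inv (M (j - 1))) (h j) x))\<^sup>2 * f j j"
    if j: "j \<in> {1..N}" for j x
    unfolding f_def by (rule form_at_equality[OF M le[OF j] Q[OF j] eq[OF j, unfolded f_def]])
  have \<mu>\<kappa>: "\<mu> j * \<kappa> j \<le> 1" if j: "j \<in> {1..N}" for j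
    unfolding \<kappa>_def g_def by (rule inverse_form_le[OF M \<mu>[OF j] le[OF j]])
  have \<mu>\<kappa>_eq: "\<mu> j * \<kappa> j = 1" if j: "j \<in> {1..N}" and pos: "f j j \<noteq> 0" for j
  proof -
    \<comment> \<open>The rank-one formula for \<open>Q j\<close>, evaluated at \<open>h j\<close>
      itself.\<close>
    have "f j j = (\<mu> j * \<kappa> j)\<^sup>2 * f j j"
      using f_eq[OF j, of "h j"] unfolding cmod_\<kappa> by (simp add: f_def power_mult_distrib)
    then have "(\<mu> j * \<kappa> j)\<^sup>2 = 1" using pos by simp
    moreover have "0 \<le> \<mu> j * \<kappa> j" using \<mu>[OF j] \<kappa>_nonneg by simp
    ultimately show ?thesis by (simp add: power2_eq_1_iff)
  qed
  \<comment> \<open>The right side is the broadcast signal-to-interference ratio, so the powers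
    \<open>p\<close> reproduce the rates of \<open>Q\<close>.\<close>
  have p\<kappa>: "p j * \<kappa> j = f j j / a j" if j: "j \<in> {1..N}" for j
  proof (cases "f j j = 0")
    case False
    have "p j * \<kappa> j = (\<mu> j * \<kappa> j) * (f j j / a j)" using q_eq[OF j] j by (simp add: p_def)
    then show ?thesis using \<mu>\<kappa>_eq[OF j False] by simp
  qed (use q_eq[OF j] j in \<open>simp add: p_def\<close>)
  have ba: "1 + p j * \<kappa> j = b j / a j" if j: "j \<in> {1..N}" for j
    using p\<kappa>[OF j] b1[OF j] apos[OF j] by (simp add: field_simps)

  \<comment> \<open>The maximiser is \<open>Q\<^sub>j = w\<^sub>j (M\<^sub>j\<^sub>-\<^sub>1\<^sup>-\<^sup>1 - M\<^sub>j\<^sup>-\<^sup>1)\<close>.\<close>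
  have f_diff: "Re (sesq (Q j) x x) = w j * (g (j - 1) x - g j x)" if j: "j \<in> {1..N}" for j x
  proof -
    define c where "c = (cmod (sesq (matrix_inv (M (j - 1))) (h j) x))\<^sup>2"
    have "w j * (g (j - 1) x - g j x) = w j * (q j * c / (b j / a j))"
      using g_diff[of j x] ba[OF j] j by (simp add: c_def p_def)
    also have "\<dots> = (\<mu> j)\<^sup>2 * c * f j j"
      unfolding q_eq[OF j] \<mu>_def using apos[OF j] bpos[OF j] by (simp add: field_simps power2_eq_square)
    finally show ?thesis using f_eq[OF j, of x] by (simp add: c_def)
  qed

  \<comment> \<open>Extending the weights by zero makes \<open>w N\<close> the last coefficient and
    removes the boundary terms of both summations by parts.\<close>
  define W where "W j = (if j \<in> {1..N} then w j else 0)" for j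
  define \<Delta> where "\<Delta> j = W j - W (Suc j)" for j
  have \<Delta>: "0 \<le> \<Delta> j" if "j \<in> {1..N}" for j
    using that w_nonneg[OF that] w_mono[of j] by (auto simp: \<Delta>_def W_def)
  \<comment> \<open>The derivative of \<open>\<Sum>j. \<Delta> j * logdet (M j)\<close> in the power
    \<open>p k\<close>, which enters \<open>M j\<close> exactly for \<open>j \<ge> k\<close>. The
    facts \<open>R_le\<close> and \<open>R_eq\<close> are the optimality conditions for that sum
    minus the total power.\<close>
  define R where "R k = (\<Sum>j=k..N. \<Delta> j * g j (h k))" for k
  have R: "R k = w k * g k (h k) - (a k - 1)" if k: "k \<in> {1..N}" for k
  proof -
    have "a k - 1 = (\<Sum>j=k+1..N. W j * (g (j - 1) (h k) - g j (h k)))"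
      unfolding a1[OF k] f_def using k by (simp add: f_diff W_def)
    then show ?thesis
      using sum_by_parts_tail[of k N W "\<lambda>j. g j (h k)"] k by (simp add: R_def \<Delta>_def W_def)
  qed
  have g_k: "g k (h k) = \<kappa> k * a k / b k" if k: "k \<in> {1..N}" for k
  proof -
    have "0 < 1 + p k * \<kappa> k" using p[of k] \<kappa>_nonneg[of k] by (simp add: add_pos_nonneg)
    then have "g k (h k) = \<kappa> k / (1 + p k * \<kappa> k)"
      using g_diff[of k "h k", folded \<kappa>_def] k unfolding cmod_\<kappa>
      by (simp add: field_simps power2_eq_square)
    then show ?thesis unfolding ba[OF k] by simp
  qed
  have wg: "w k * g k (h k) = (\<mu> k * \<kappa> k) * a k" if k: "k \<in> {1..N}" for k
    unfolding g_k[OF k] \<mu>_def by simp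
  have R_le: "R k \<le> 1" if k: "k \<in> {1..N}" for k
  proof -
    have "(\<mu> k * \<kappa> k) * a k \<le> 1 * a k"
      using \<mu>\<kappa>[OF k] apos[OF k] by (intro mult_right_mono) auto
    then show ?thesis unfolding R[OF k] wg[OF k] by simp
  qed
  have R_eq: "R k = 1 \<or> p k = 0" if k: "k \<in> {1..N}" for k
  proof (cases "f k k = 0")
    case True
    then show ?thesis using q_eq[OF k] k by (simp add: p_def)
  next
    case False
    then show ?thesis unfolding R[OF k] wg[OF k] using \<mu>\<kappa>_eq[OF k] by simp
  qed

  obtain p' where p': "\<And>j. 0 \<le> p' j"
    and p'_sum: "(\<Sum>j=1..N. p' j) \<le> (\<Sum>j=1..N. Re (trace (diag_mat lam ** Q' j)))"
    and p'_ln: "\<And>j. j \<in> {1..N} \<Longrightarrow> ln (1 + Re (sesq (Q' j) (h j) (h j)) / a' j)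
      = logdet (mac_cov lam h p' j) - logdet (mac_cov lam h p' (j - 1))"
    using broadcast_to_mac[where Q = Q' and a = a' and N = N and h = h, OF lam Q' a'] by blast
  define l l' where "l j = logdet (M j)" and "l' j = logdet (mac_cov lam h p' j)" for j
  have M': "posdef (mac_cov lam h p' j)" for j by (rule posdef_mac_cov[OF lam p'])
  have l0: "l' 0 = l 0" by (simp add: l_def l'_def M_def mac_cov_0)
  have tangent: "l' j - l j \<le> (\<Sum>m=1..j. (p' m - p m) * g j (h m))" for j
  proof -
    let ?G = "matrix_inv (M j)"
    have "l' j - l j \<le> Re (trace (?G ** mac_cov lam h p' j)) - CARD('n)"
      unfolding l_def l'_def by (rule logdet_tangent[OF M' M])
    also have "real CARD('n) = Re (trace (?G ** mac_cov lam h p j))"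
      using posdef_inverse(1)[OF M[of j]] by (simp add: M_def trace_I)
    finally show ?thesis unfolding trace_mult_mac_cov g_def .
  qed
  have parts: "(\<Sum>j=1..N. w j * (x j - x (j - 1))) = (\<Sum>j=1..N. \<Delta> j * (x j - x 0))" for x
  proof -
    have "(\<Sum>j=1..N. w j * (x j - x (j - 1))) = (\<Sum>j=1..N. W j * (x j - x (j - 1)))"
      by (intro sum.cong) (auto simp: W_def)
    then show ?thesis
      unfolding sum_by_parts_from_0 by (simp add: \<Delta>_def W_def)
  qed
  have "(\<Sum>j=1..N. w j * (l' j - l' (j - 1))) - (\<Sum>j=1..N. w j * (l j - l (j - 1)))
      = (\<Sum>j=1..N. \<Delta> j * (l' j - l j))"
    unfolding parts l0 by (simp add: sum_subtractf[symmetric] right_diff_distrib)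
  also have "\<dots> \<le> (\<Sum>j=1..N. \<Delta> j * (\<Sum>m=1..j. (p' m - p m) * g j (h m)))"
    using \<Delta> tangent by (intro sum_mono mult_left_mono) auto
  also have "\<dots> = (\<Sum>j\<in>{1..N}. \<Sum>m | m \<in> {1..N} \<and> m \<le> j. (p' m - p m) * (\<Delta> j * g j (h m)))"
    unfolding sum_distrib_left by (intro sum.cong) (auto simp: mult_ac)
  also have "\<dots> = (\<Sum>m\<in>{1..N}. \<Sum>j | j \<in> {1..N} \<and> m \<le> j. (p' m - p m) * (\<Delta> j * g j (h m)))"
    by (rule sum.swap_restrict) auto
  also have "\<dots> = (\<Sum>m=1..N. (p' m - p m) * R m)"
    unfolding R_def sum_distrib_left by (intro sum.cong) auto
  also have "\<dots> \<le> (\<Sum>m=1..N. p' m - p m)"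
  proof (rule sum_mono)
    fix m assume m: "m \<in> {1..N}"
    \<comment> \<open>Either \<open>R m = 1\<close>, or \<open>p m = 0\<close> and the claim is
      \<open>p' m * R m \<le> p' m\<close>.\<close>
    show "(p' m - p m) * R m \<le> p' m - p m"
      using R_eq[OF m] R_le[OF m] p'[of m] mult_left_mono[of "R m" 1 "p' m"] by auto
  qed
  also have "\<dots> = (\<Sum>m=1..N. p' m) - (\<Sum>m=1..N. p m)" by (rule sum_subtractf)
  finally have main: "(\<Sum>j=1..N. w j * (l' j - l' (j - 1))) - (\<Sum>m=1..N. p' m)
      \<le> (\<Sum>j=1..N. w j * (l j - l (j - 1))) - (\<Sum>m=1..N. p m)" by simp
  have "(\<Sum>j=1..N. w j * ln (1 + Re (sesq (Q' j) (h j) (h j)) / a' j))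
      = (\<Sum>j=1..N. w j * (l' j - l' (j - 1)))"
    by (intro sum.cong) (auto simp: p'_ln l'_def)
  moreover have "(\<Sum>j=1..N. w j * ln (1 + Re (sesq (Q j) (h j) (h j)) / a j))
      = (\<Sum>j=1..N. w j * (l j - l (j - 1)))"
  proof (intro sum.cong refl)
    fix j assume j: "j \<in> {1..N}"
    have "l j - l (j - 1) = ln (1 + p j * \<kappa> j)"
      using logdet_mac_cov_step[where lam=lam and h=h and q=p and j=j, OF lam p] j
      by (simp add: l_def M_def \<kappa>_def g_def)
    then show "w j * ln (1 + Re (sesq (Q j) (h j) (h j)) / a j) = w j * (l j - l (j - 1))"
      using p\<kappa>[OF j] by (simp add: f_def)
  qed
  \<comment> \<open>Here powers and covariances cost the same, because \<open>kkt_eq\<close> takes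
    the place of the trace bound in \<open>broadcast_to_mac\<close>.\<close>
  moreover have "(\<Sum>m=1..N. p m) = (\<Sum>k=1..N. Re (trace (diag_mat lam ** Q k)))"
  proof -
    have "(\<Sum>j=1..N. p j) = (\<Sum>k=1..N. \<mu> k * f k k - (\<Sum>j=1..k-1. p j * f j k))"
      by (rule mac_power_sum[OF a1 apos]) (simp_all add: p_def q_eq)
    also have "\<dots> = (\<Sum>k=1..N. Re (trace (diag_mat lam ** Q k)))"
    proof (intro sum.cong refl)
      fix k assume "k \<in> {1..N}"
      from eq[OF this, unfolded M_def trace_mac_cov]
      show "\<mu> k * f k k - (\<Sum>j=1..k-1. p j * f j k) = Re (trace (diag_mat lam ** Q k))"
        by (simp add: f_def)
    qed
    finally show ?thesis .
  qed
  ultimately show ?thesis using main p'_sum by linarith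
qed

section \<open>Existence of optima and of multipliers\<close>

lemma psd_0: "psd 0"
  by (intro psdI) (simp_all add: hermitian_iff sesq_eq_sum)

lemma psd_add: "psd A \<Longrightarrow> psd B \<Longrightarrow> psd (A + B)"
  by (rule psdI) (simp_all add: hermitian_add psd_hermitian sesq_add_mat psd_form_nonneg)

lemma psd_scale: "psd A \<Longrightarrow> 0 \<le> c \<Longrightarrow> psd (c *\<^sub>R A)"
  by (rule psdI) (simp_all add: hermitian_scale psd_hermitian sesq_scale_mat psd_form_nonneg)

lemma sesq_axis: "sesq A (axis l 1) (axis m 1) = A $ l $ m"
proof -
  have "(\<Sum>j\<in>UNIV. axis l 1 $ i * A $ i $ j * cnj (axis m 1 $ j)) = (if i = l then A $ l $ m else 0)" for i
  proof -
    have "(\<Sum>j\<in>UNIV. axis l 1 $ i * A $ i $ j * cnj (axis m 1 $ j))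
        = (\<Sum>j\<in>UNIV. if j = m then axis l 1 $ i * A $ i $ j else 0)"
      by (intro sum.cong) (auto simp: axis_def)
    then show ?thesis by (auto simp: axis_def)
  qed
  then show ?thesis unfolding sesq_eq_sum by simp
qed

lemma psd_diag_nonneg: "psd A \<Longrightarrow> 0 \<le> Re (A $ l $ l)"
  using psd_form_nonneg[of A "axis l 1"] by (simp add: sesq_axis)

lemma Re_trace_diag_mat: "Re (trace (diag_mat d ** A)) = (\<Sum>l\<in>UNIV. d $ l * Re (A $ l $ l))"
  by (simp add: trace_diag_mat_mult)

lemma closed_psd: "closed {A :: complex ^ 'n ^ 'n. psd A}"
proof -
  have eq: "{A :: complex ^ 'n ^ 'n. psd A} =
    (\<Inter>i. \<Inter>j. {A. cnj (A $ j $ i) = A $ i $ j}) \<inter> (\<Inter>x. {A. 0 \<le> Re (sesq A x x)})"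
    by (auto simp: psd_def herm_form_eq_sesq hermitian_iff)
  show ?thesis
    unfolding eq sesq_eq_sum
    by (intro closed_Int closed_INT ballI closed_Collect_eq closed_Collect_le continuous_intros)
qed

text \<open>Cauchy-Schwarz on unit vectors bounds each entry by the diagonal, so the diagonal
  constraints bound the whole matrix.\<close>

lemma compact_psd_bounded:
  "compact {A :: complex ^ 'n ^ 'n. psd A \<and> (\<forall>l. Re (A $ l $ l) \<le> P $ l)}" (is "compact ?S")
proof -
  have "closed ((\<Inter>l. {A :: complex ^ 'n ^ 'n. Re (A $ l $ l) \<le> P $ l}))"
    by (intro closed_INT ballI closed_Collect_le continuous_intros)
  then have "closed ?S"
    using closed_Int[OF closed_psd] by (simp add: Collect_conj_eq Collect_all_eq)
  moreover have "bounded ?S"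
  proof (rule boundedI)
    fix A assume A: "A \<in> ?S"
    define c where "c = (\<Sum>l\<in>UNIV. \<bar>P $ l\<bar>)"
    have diag: "0 \<le> Re (A $ l $ l)" "Re (A $ l $ l) \<le> c" for l
    proof -
      show "0 \<le> Re (A $ l $ l)" using A psd_diag_nonneg by blast
      have "Re (A $ l $ l) \<le> P $ l" using A by blast
      also have "\<dots> \<le> \<bar>P $ l\<bar>" by simp
      also have "\<dots> \<le> c" unfolding c_def by (intro member_le_sum) auto
      finally show "Re (A $ l $ l) \<le> c" .
    qed
    have entry: "cmod (A $ l $ m) \<le> c" for l m
    proof (rule power2_le_imp_le)
      have "(cmod (A $ l $ m))\<^sup>2 \<le> Re (A $ l $ l) * Re (A $ m $ m)"
        using psd_Cauchy_Schwarz[of A "axis l 1" "axis m 1"] A by (simp add: sesq_axis)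
      also have "\<dots> \<le> c * c" using diag by (intro mult_mono) (auto intro: order_trans)
      finally show "(cmod (A $ l $ m))\<^sup>2 \<le> c\<^sup>2" by (simp add: power2_eq_square)
      show "0 \<le> c" by (simp add: c_def sum_nonneg)
    qed
    have "norm A \<le> (\<Sum>l\<in>UNIV. norm (A $ l))" by (simp add: norm_vec_def L2_set_le_sum)
    also have "\<dots> \<le> (\<Sum>l\<in>(UNIV::'n set). \<Sum>m\<in>(UNIV::'n set). c)"
    proof (rule sum_mono)
      fix l
      have "norm (A $ l) \<le> (\<Sum>m\<in>UNIV. norm (A $ l $ m))" by (simp add: norm_vec_def L2_set_le_sum)
      also have "\<dots> \<le> (\<Sum>m\<in>(UNIV::'n set). c)" by (intro sum_mono entry)
      finally show "norm (A $ l) \<le> (\<Sum>m\<in>(UNIV::'n set). c)" .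
    qed
    finally show "norm A \<le> (\<Sum>l\<in>(UNIV::'n set). \<Sum>m\<in>(UNIV::'n set). c)" .
  qed
  ultimately show ?thesis by (simp add: compact_eq_bounded_closed)
qed

lemma compact_Pi_UNIV:
  fixes S :: "'i \<Rightarrow> 'b :: topological_space set"
  assumes "\<And>i. compact (S i)"
  shows "compact {f. \<forall>i. f i \<in> S i}"
proof -
  have "compactin (product_topology (\<lambda>i. euclidean) UNIV) (PiE UNIV S)"
    unfolding compactin_PiE using assms by simp
  moreover have "PiE UNIV S = {f. \<forall>i. f i \<in> S i}" by auto
  ultimately show ?thesis unfolding euclidean_product_topology by simp
qed

section \<open>Attainment of the primal maximum\<close>

lemma interference_eq:
  "interference N h Q i j = 1 + (\<Sum>k=j+1..N. Re (sesq (Q i k) (h i j) (h i j)))"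
proof -
  have "sesq (\<Sum>k\<in>A. Q i k) x x = (\<Sum>k\<in>A. sesq (Q i k) x x)" if "finite A" for A x
    using that by (induct A rule: finite_induct) (simp_all add: sesq_add_mat, simp add: sesq_eq_sum)
  then show ?thesis by (simp add: interference_def herm_form_eq_sesq)
qed

lemma psd_familyD: "Q \<in> psd_family N Nc \<Longrightarrow> i \<in> {1..Nc} \<Longrightarrow> j \<in> {1..N} \<Longrightarrow> psd (Q i j)"
  by (simp add: psd_family_def)

lemma interference_ge_1:
  assumes "Q \<in> psd_family N Nc" "i \<in> {1..Nc}"
  shows "1 \<le> interference N h Q i j"
  unfolding interference_eq using assms
  by (auto intro!: sum_nonneg psd_form_nonneg simp: psd_family_def)

lemma C_BC_eq:
  "C_BC N Nc h w Q = (\<Sum>i=1..Nc. \<Sum>j=1..N. w j / ln 2 *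
     ln (1 + Re (sesq (Q i j) (h i j) (h i j)) / interference N h Q i j))"
  unfolding C_BC_def sum_distrib_left
  by (subst sum.swap) (simp add: log_def herm_form_eq_sesq)

text \<open>Families are unrestricted outside the index ranges, so \<open>feasible\<close> itself is
  not compact. The maximum is taken over families uncurried to pairs and set to zero there, compact
  by Tychonoff; values outside the ranges do not affect \<open>C_BC\<close>.\<close>

lemma primal_attained:
  fixes P :: "real ^ 'l"
  assumes P: "\<And>l. 0 \<le> P $ l"
  shows "\<exists>Q\<in>feasible N Nc P. \<forall>Q'\<in>feasible N Nc P. C_BC N Nc h w Q' \<le> C_BC N Nc h w Q"
proof -
  define I where "I = {1..Nc} \<times> {1..N}"
  define S :: "nat \<times> nat \<Rightarrow> (complex ^ 'l ^ 'l) set" where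
    "S p = (if p \<in> I then {A. psd A \<and> (\<forall>l. Re (A $ l $ l) \<le> P $ l)} else {0})" for p
  define fam where "fam q i j = q (i, j)" for q :: "nat \<times> nat \<Rightarrow> complex ^ 'l ^ 'l" and i j
  define K where "K = {q. \<forall>p. q p \<in> S p} \<inter>
    (\<Inter>l. {q. (\<Sum>j=1..N. \<Sum>i=1..Nc. Re (q (i, j) $ l $ l)) \<le> P $ l})"
  have coord: "continuous_on A (\<lambda>q. q p)" for A p and q :: "nat \<times> nat \<Rightarrow> complex ^ 'l ^ 'l"
    by (rule continuous_on_subset[OF continuous_on_product_coordinates]) simp
  have "compact {q. \<forall>p. q p \<in> S p}"
    by (rule compact_Pi_UNIV) (simp add: S_def compact_psd_bounded)
  moreover have "closed (\<Inter>l. {q :: nat \<times> nat \<Rightarrow> complex ^ 'l ^ 'l.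
      (\<Sum>j=1..N. \<Sum>i=1..Nc. Re (q (i, j) $ l $ l)) \<le> P $ l})"
    by (intro closed_INT ballI closed_Collect_le continuous_intros coord)
  ultimately have "compact K" unfolding K_def by (rule compact_Int_closed)
  have fam_psd: "fam q \<in> psd_family N Nc" if "q \<in> K" for q
    unfolding psd_family_def
  proof safe
    fix i j assume "i \<in> {1..Nc}" "j \<in> {1..N}"
    then have "(i, j) \<in> I" by (simp add: I_def)
    moreover have "q (i, j) \<in> S (i, j)" using that by (simp add: K_def)
    ultimately show "psd (fam q i j)" by (simp add: fam_def S_def)
  qed
  have fam_feasible: "fam q \<in> feasible N Nc P" if "q \<in> K" for q
    using fam_psd[OF that] that by (simp add: feasible_def K_def fam_def)
  have "(\<lambda>p. 0) \<in> K" using P by (auto simp: K_def S_def psd_0)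
  then have "K \<noteq> {}" by blast
  have sesq_cont: "continuous_on K (\<lambda>q. Re (sesq (q p) x x))" for p x
    unfolding sesq_eq_sum by (intro continuous_intros coord)
  have int_cont: "continuous_on K (\<lambda>q. interference N h (fam q) i j)" for i j
    unfolding interference_eq fam_def by (intro continuous_intros sesq_cont)
  have "continuous_on K (\<lambda>q. C_BC N Nc h w (fam q))"
    unfolding C_BC_eq
  proof (intro continuous_on_sum continuous_on_mult continuous_on_const continuous_on_ln
      continuous_on_add continuous_on_divide int_cont)
    fix i j
    show "continuous_on K (\<lambda>q. Re (sesq (fam q i j) (h i j) (h i j)))"
      unfolding fam_def by (rule sesq_cont)
    assume ij: "i \<in> {1..Nc}" "j \<in> {1..N}"
    show "\<forall>q\<in>K. interference N h (fam q) i j \<noteq> 0"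
      using interference_ge_1[OF fam_psd ij(1), of _ h j] by force
    show "\<forall>q\<in>K. 1 + Re (sesq (fam q i j) (h i j) (h i j)) / interference N h (fam q) i j \<noteq> 0"
    proof
      fix q assume "q \<in> K"
      then have "0 \<le> Re (sesq (fam q i j) (h i j) (h i j)) / interference N h (fam q) i j"
        using interference_ge_1[OF fam_psd ij(1), of q h j] psd_form_nonneg[OF psd_familyD[OF fam_psd ij]]
        by (intro divide_nonneg_nonneg) auto
      then show "1 + Re (sesq (fam q i j) (h i j) (h i j)) / interference N h (fam q) i j \<noteq> 0" by simp
    qed
  qed
  then obtain q where q: "q \<in> K" "\<And>q'. q' \<in> K \<Longrightarrow> C_BC N Nc h w (fam q') \<le> C_BC N Nc h w (fam q)"
    using continuous_attains_sup[OF \<open>compact K\<close> \<open>K \<noteq> {}\<close>] by metis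
  have "C_BC N Nc h w Q \<le> C_BC N Nc h w (fam q)" if Q: "Q \<in> feasible N Nc P" for Q
  proof -
    define q' where "q' = (\<lambda>(i, j). if (i, j) \<in> I then Q i j else 0)"
    have psd: "psd (Q i j)" if "(i, j) \<in> I" for i j
      using Q that by (auto simp: feasible_def psd_family_def I_def)
    have pw: "(\<Sum>j=1..N. \<Sum>i=1..Nc. Re (Q i j $ l $ l)) \<le> P $ l" for l
      using Q by (simp add: feasible_def)
    have diag: "Re (Q i j $ l $ l) \<le> P $ l" if ij: "(i, j) \<in> I" for i j l
    proof -
      have "Re (Q i j $ l $ l) \<le> (\<Sum>i=1..Nc. Re (Q i j $ l $ l))"
        using ij by (intro member_le_sum psd_diag_nonneg psd) (auto simp: I_def)
      also have "\<dots> \<le> (\<Sum>j=1..N. \<Sum>i=1..Nc. Re (Q i j $ l $ l))"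
        using ij by (intro member_le_sum[of j "{1..N}" "\<lambda>j. \<Sum>i=1..Nc. Re (Q i j $ l $ l)"] sum_nonneg psd_diag_nonneg psd) (auto simp: I_def)
      finally show ?thesis using pw[of l] by simp
    qed
    have eq: "fam q' i j = Q i j" if "i \<in> {1..Nc}" "j \<in> {1..N}" for i j
      using that by (simp add: fam_def q'_def I_def)
    have "q' \<in> K"
      unfolding K_def
    proof (intro IntI CollectI INT_I allI)
      fix p show "q' p \<in> S p"
        using psd diag by (cases p) (auto simp: q'_def S_def)
      fix l
      show "(\<Sum>j=1..N. \<Sum>i=1..Nc. Re (q' (i, j) $ l $ l)) \<le> P $ l"
        using pw[of l] eq by (simp add: fam_def)
    qed
    moreover have "C_BC N Nc h w (fam q') = C_BC N Nc h w Q"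
      unfolding C_BC_eq interference_eq by (intro sum.cong refl) (auto simp: eq)
    ultimately show ?thesis using q(2) by metis
  qed
  then show ?thesis using fam_feasible[OF q(1)] by blast
qed

section \<open>Lagrange multipliers for a linear objective\<close>

definition pow_used :: "nat \<Rightarrow> nat \<Rightarrow> (nat \<Rightarrow> nat \<Rightarrow> complex ^ 'l ^ 'l) \<Rightarrow> 'l \<Rightarrow> real" where
  "pow_used N Nc Q l = (\<Sum>j=1..N. \<Sum>i=1..Nc. Re (Q i j $ l $ l))"

lemma sum_trace_diag_mat:
  "(\<Sum>i=1..Nc. \<Sum>j=1..N. Re (trace (diag_mat d ** X i j))) = (\<Sum>l\<in>UNIV. d $ l * pow_used N Nc X l)"
proof -
  have "(\<Sum>l\<in>UNIV. d $ l * pow_used N Nc X l)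
      = (\<Sum>l\<in>UNIV. \<Sum>j=1..N. \<Sum>i=1..Nc. d $ l * Re (X i j $ l $ l))"
    by (simp add: pow_used_def sum_distrib_left)
  also have "\<dots> = (\<Sum>j=1..N. \<Sum>l\<in>UNIV. \<Sum>i=1..Nc. d $ l * Re (X i j $ l $ l))"
    by (rule sum.swap)
  also have "\<dots> = (\<Sum>j=1..N. \<Sum>i=1..Nc. \<Sum>l\<in>UNIV. d $ l * Re (X i j $ l $ l))"
    by (intro sum.cong refl sum.swap)
  also have "\<dots> = (\<Sum>i=1..Nc. \<Sum>j=1..N. \<Sum>l\<in>UNIV. d $ l * Re (X i j $ l $ l))"
    by (rule sum.swap)
  finally show ?thesis by (simp add: Re_trace_diag_mat)
qed

text \<open>Separate zero from the attainable pairs of excess power and objective loss, with the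
  zero family as strictly feasible point. Since psd families form a cone, the part of the Lagrangian
  that depends on the family is homogeneous; its maximum is zero and splits over tones and
  users.\<close>

lemma conic_multipliers:
  fixes J :: "nat \<Rightarrow> nat \<Rightarrow> complex ^ 'l ^ 'l \<Rightarrow> real" and P :: "real ^ 'l"
  assumes add: "\<And>i j X Y. J i j (X + Y) = J i j X + J i j Y"
    and scale: "\<And>i j c X. J i j (c *\<^sub>R X) = c * J i j X"
    and P: "\<And>l. 0 < P $ l" and Q: "Q \<in> feasible N Nc P"
    and max: "\<And>Q'. Q' \<in> feasible N Nc P \<Longrightarrow>
      (\<Sum>i=1..Nc. \<Sum>j=1..N. J i j (Q' i j)) \<le> (\<Sum>i=1..Nc. \<Sum>j=1..N. J i j (Q i j))"
  obtains lam where "\<And>l. 0 \<le> lam $ l" "(\<Sum>l\<in>UNIV. lam $ l * (P $ l - pow_used N Nc Q l)) = 0"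
    "\<And>i j X. i \<in> {1..Nc} \<Longrightarrow> j \<in> {1..N} \<Longrightarrow> psd X \<Longrightarrow> J i j X \<le> Re (trace (diag_mat lam ** X))"
    "\<And>i j. i \<in> {1..Nc} \<Longrightarrow> j \<in> {1..N} \<Longrightarrow> J i j (Q i j) = Re (trace (diag_mat lam ** Q i j))"
proof -
  let ?F = "psd_family N Nc :: (nat \<Rightarrow> nat \<Rightarrow> complex ^ 'l ^ 'l) set"
  define T where "T Q = (\<Sum>i=1..Nc. \<Sum>j=1..N. J i j (Q i j))" for Q
  define comb where "comb s A t B = (\<lambda>i j. s *\<^sub>R A i j + t *\<^sub>R B i j)"
    for s t :: real and A B :: "nat \<Rightarrow> nat \<Rightarrow> complex ^ 'l ^ 'l"
  have T_comb: "T (comb s A t B) = s * T A + t * T B" for s A t B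
    by (simp add: T_def comb_def add scale sum.distrib sum_distrib_left)
  have pow_comb: "pow_used N Nc (comb s A t B) l = s * pow_used N Nc A l + t * pow_used N Nc B l" for s A t B l
    by (simp add: pow_used_def comb_def sum.distrib sum_distrib_left)
  have psd_comb: "comb s A t B \<in> ?F" if "A \<in> ?F" "B \<in> ?F" "0 \<le> s" "0 \<le> t" for s A t B
    using that by (auto simp: psd_family_def comb_def intro!: psd_add psd_scale)
  have feas_iff: "X \<in> feasible N Nc P \<longleftrightarrow> X \<in> ?F \<and> (\<forall>l. pow_used N Nc X l \<le> P $ l)" for X
    by (simp add: feasible_def pow_used_def)
  have QF: "Q \<in> ?F" using Q feas_iff by blast
  \<comment> \<open>With strict inequalities, zero in \<open>S\<close> would mean a feasible family
    with a larger objective than \<open>Q\<close>.\<close>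
  define S :: "((real ^ 'l) \<times> real) set" where "S = {z. \<exists>X\<in>?F.
    (\<forall>l. pow_used N Nc X l - P $ l < fst z $ l) \<and> T Q - T X < snd z}"
  have "convex S"
    unfolding convex_def
  proof (intro ballI allI impI)
    fix y z :: "(real ^ 'l) \<times> real" and s t :: real
    assume "y \<in> S" "z \<in> S" and st: "0 \<le> s" "0 \<le> t" "s + t = 1"
    then obtain A B where A: "A \<in> ?F" "\<And>l. pow_used N Nc A l - P $ l < fst y $ l" "T Q - T A < snd y"
      and B: "B \<in> ?F" "\<And>l. pow_used N Nc B l - P $ l < fst z $ l" "T Q - T B < snd z"
      unfolding S_def by blast
    have mono: "s * a + t * b < s * a' + t * b'" if "a < a'" "b < b'" for a b a' b'
    proof (cases "s = 0")
      case False
      then show ?thesis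
        using that st by (intro add_less_le_mono mult_strict_left_mono mult_left_mono) auto
    qed (use that st in simp)
    have one: "s * p + t * p = p" for p :: real
      using st(3) by (metis distrib_right mult_1)
    show "s *\<^sub>R y + t *\<^sub>R z \<in> S"
      unfolding S_def
    proof (intro CollectI bexI[of _ "comb s A t B"] conjI allI)
      fix l
      show "pow_used N Nc (comb s A t B) l - P $ l < fst (s *\<^sub>R y + t *\<^sub>R z) $ l"
        using mono[OF A(2)[of l] B(2)[of l]] one[of "P $ l"] by (simp add: pow_comb algebra_simps)
      show "T Q - T (comb s A t B) < snd (s *\<^sub>R y + t *\<^sub>R z)"
        using mono[OF A(3) B(3)] one[of "T Q"] by (simp add: T_comb algebra_simps)
    qed (use psd_comb A B st in auto)
  qed
  moreover have "0 \<notin> S"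
  proof
    assume "0 \<in> S"
    then obtain X where X: "X \<in> ?F" "\<And>l. pow_used N Nc X l < P $ l" "T Q < T X"
      unfolding S_def by auto
    then have "X \<in> feasible N Nc P" by (simp add: feas_iff less_imp_le)
    then show False using max X(3) unfolding T_def by fastforce
  qed
  ultimately obtain z where z: "z \<noteq> 0" "\<And>x. x \<in> S \<Longrightarrow> 0 \<le> z \<bullet> x"
    using separating_hyperplane_set_0[of S] by blast
  define mu where "mu = fst z"
  define tau where "tau = snd z"
  have zx: "z \<bullet> (u, r) = (\<Sum>l\<in>UNIV. mu $ l * u $ l) + tau * r" for u r
    by (cases z) (simp add: mu_def tau_def inner_vec_def)
  \<comment> \<open>Shifting all coordinates by \<open>d\<close> leads into \<open>S\<close>; the
    choice of \<open>c\<close> keeps the effect on the functional at most \<open>e\<close>.\<close>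
  have sep: "0 \<le> (\<Sum>l\<in>UNIV. mu $ l * u $ l) + tau * r"
    if "X \<in> ?F" "\<And>l. pow_used N Nc X l - P $ l \<le> u $ l" "T Q - T X \<le> r" for X u r
  proof (rule field_le_epsilon)
    fix e :: real assume e: "0 < e"
    define c where "c = \<bar>\<Sum>l\<in>UNIV. mu $ l\<bar> + \<bar>tau\<bar> + 1"
    define d where "d = e / c"
    have c: "0 < c" by (simp add: c_def)
    then have d: "0 < d" using e by (simp add: d_def)
    have "(\<chi> l. u $ l + d, r + d) \<in> S"
      unfolding S_def
    proof (intro CollectI bexI[of _ X] conjI allI)
      show "pow_used N Nc X l - P $ l < fst (\<chi> l. u $ l + d, r + d) $ l" for l
        using that(2)[of l] d by simp
    qed (use that d in auto)
    then have "0 \<le> (\<Sum>l\<in>UNIV. mu $ l * (u $ l + d)) + tau * (r + d)"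
      using z(2) by (fastforce simp: zx)
    also have "\<dots> = (\<Sum>l\<in>UNIV. mu $ l * u $ l) + tau * r + d * ((\<Sum>l\<in>UNIV. mu $ l) + tau)"
      by (simp add: ring_distribs sum.distrib sum_distrib_left mult_ac)
    also have "d * ((\<Sum>l\<in>UNIV. mu $ l) + tau) \<le> d * c"
      using d by (intro mult_left_mono) (auto simp: c_def)
    also have "d * c = e" using c by (simp add: d_def)
    finally show "0 \<le> (\<Sum>l\<in>UNIV. mu $ l * u $ l) + tau * r + e" by simp
  qed
  have linear_nonneg: "0 \<le> b" if "\<And>s. 0 \<le> s \<Longrightarrow> 0 \<le> a + s * b" for a b :: real
  proof (rule ccontr)
    assume "\<not> 0 \<le> b"
    then have "((\<bar>a\<bar> + 1) / (- b)) * b = - (\<bar>a\<bar> + 1)" by simp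
    then have "a + ((\<bar>a\<bar> + 1) / (- b)) * b < 0" by linarith
    moreover have "0 \<le> (\<bar>a\<bar> + 1) / (- b)" using \<open>\<not> 0 \<le> b\<close> by (intro divide_nonneg_nonneg) auto
    ultimately show False using that by fastforce
  qed
  have Q_pow: "pow_used N Nc Q l \<le> P $ l" for l using Q feas_iff by blast
  have Q_slack: "pow_used N Nc Q l - P $ l \<le> 0" for l using Q_pow[of l] by simp
  have mu: "0 \<le> mu $ l" for l
  proof (rule linear_nonneg)
    fix s :: real assume "0 \<le> s"
    then have "0 \<le> (\<Sum>m\<in>UNIV. mu $ m * (axis l s) $ m) + tau * 0"
      using \<open>0 \<le> s\<close> by (intro sep[OF QF]) (auto simp: axis_def Q_pow intro: order_trans[OF Q_slack])
    also have "(\<Sum>m\<in>UNIV. mu $ m * (axis l s) $ m) = (\<Sum>m\<in>UNIV. if m = l then mu $ l * s else 0)"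
      by (intro sum.cong) (auto simp: axis_def)
    finally show "0 \<le> 0 + s * mu $ l" by (simp add: mult.commute)
  qed
  have tau: "0 \<le> tau"
  proof (rule linear_nonneg)
    fix s :: real assume "0 \<le> s"
    then have "0 \<le> (\<Sum>m\<in>UNIV. mu $ m * (0 :: real ^ 'l) $ m) + tau * s"
      using \<open>0 \<le> s\<close> by (intro sep[OF QF]) (auto simp: Q_pow)
    then show "0 \<le> 0 + s * tau" by (simp add: mult.commute)
  qed
  have zero: "(\<lambda>i j. 0) \<in> ?F" "T (\<lambda>i j. 0) = 0" "pow_used N Nc (\<lambda>i j. 0) l = 0" for l
    using scale[of _ _ 0 0] by (simp_all add: psd_family_def psd_0 T_def pow_used_def)
  \<comment> \<open>Otherwise the zero family gives \<open>mu \<bullet> P \<le> 0\<close>, which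
    forces \<open>mu = 0\<close> because \<open>P\<close> is positive.\<close>
  have "tau \<noteq> 0"
  proof
    assume "tau = 0"
    have "0 \<le> (\<Sum>l\<in>UNIV. mu $ l * (- P) $ l) + tau * T Q"
      by (rule sep[OF zero(1)]) (simp_all add: zero)
    then have "(\<Sum>l\<in>UNIV. mu $ l * P $ l) \<le> 0" by (simp add: \<open>tau = 0\<close> sum_negf)
    moreover have nn: "0 \<le> mu $ l * P $ l" for l using mu P by (simp add: less_imp_le)
    ultimately have "(\<Sum>l\<in>UNIV. mu $ l * P $ l) = 0" by (meson order_antisym sum_nonneg)
    then have "mu $ l * P $ l = 0" for l using nn by (simp add: sum_nonneg_eq_0_iff)
    then have "mu = 0" using P by (metis less_irrefl mult_eq_0_iff Finite_Cartesian_Product.vec_eq_iff zero_index)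
    then show False using z(1) \<open>tau = 0\<close> by (simp add: mu_def tau_def prod_eq_iff)
  qed
  then have tau: "0 < tau" using tau by simp
  define lam where "lam = (1 / tau) *\<^sub>R mu"
  have lam: "0 \<le> lam $ l" for l using mu tau by (simp add: lam_def)
  define H where "H X = T X - (\<Sum>l\<in>UNIV. lam $ l * pow_used N Nc X l)" for X
  have H_comb: "H (comb s A t B) = s * H A + t * H B" for s A t B
    by (simp add: H_def T_comb pow_comb ring_distribs sum.distrib sum_distrib_left mult_ac)
  have key: "H X \<le> T Q - (\<Sum>l\<in>UNIV. lam $ l * P $ l)" if X: "X \<in> ?F" for X
  proof -
    define u :: "real ^ 'l" where "u = (\<chi> l. pow_used N Nc X l - P $ l)"
    have "0 \<le> (\<Sum>l\<in>UNIV. mu $ l * u $ l) + tau * (T Q - T X)"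
      by (rule sep[OF X]) (simp_all add: u_def)
    then have "0 \<le> ((\<Sum>l\<in>UNIV. mu $ l * u $ l) + tau * (T Q - T X)) / tau"
      using tau by simp
    also have "\<dots> = (\<Sum>l\<in>UNIV. lam $ l * u $ l) + (T Q - T X)"
      using tau by (simp add: lam_def add_divide_distrib sum_divide_distrib)
    finally show ?thesis
      by (simp add: H_def u_def right_diff_distrib sum_subtractf)
  qed
  have slack_nonneg: "0 \<le> (\<Sum>l\<in>UNIV. lam $ l * (P $ l - pow_used N Nc Q l))"
    using lam Q_pow by (intro sum_nonneg mult_nonneg_nonneg) auto
  have slack: "(\<Sum>l\<in>UNIV. lam $ l * (P $ l - pow_used N Nc Q l)) = 0"
    using key[OF QF] slack_nonneg by (simp add: H_def right_diff_distrib sum_subtractf)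
  then have "T Q - (\<Sum>l\<in>UNIV. lam $ l * P $ l) = H Q"
    by (simp add: H_def right_diff_distrib sum_subtractf)
  with key have H_max: "H X \<le> H Q" if "X \<in> ?F" for X using that by metis
  \<comment> \<open>Compare with the doubled and the zero family: a homogeneous maximum can only be
    zero.\<close>
  have "H (comb 2 Q 0 Q) \<le> H Q" "H (comb 0 Q 0 Q) \<le> H Q"
    using QF by (auto intro!: H_max psd_comb)
  then have HQ: "H Q = 0" unfolding H_comb by simp

  define t where "t i j X = J i j X - Re (trace (diag_mat lam ** X))" for i j X
  have H_eq: "H X = (\<Sum>i=1..Nc. \<Sum>j=1..N. t i j (X i j))" for X
    unfolding H_def T_def t_def sum_subtractf sum_trace_diag_mat ..
  have t0: "t i j 0 = 0" for i j
    using scale[of i j 0 0] by (simp add: t_def trace_def)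
  have t_le: "t i j X \<le> 0" if ij: "i \<in> {1..Nc}" "j \<in> {1..N}" and X: "psd X" for i j X
  proof -
    define Y where "Y i' j' = (if i' = i \<and> j' = j then X else 0)" for i' j' :: nat
    have "(\<Sum>i'=1..Nc. \<Sum>j'=1..N. t i' j' (Y i' j'))
        = (\<Sum>i'=1..Nc. \<Sum>j'=1..N. if i' = i then (if j' = j then t i j X else 0) else 0)"
      by (intro sum.cong refl) (auto simp: Y_def t0)
    also have "\<dots> = (\<Sum>i'=1..Nc. if i' = i then t i j X else 0)"
      using ij(2) by (intro sum.cong refl) simp
    also have "\<dots> = t i j X" using ij(1) by simp
    finally have "H Y = t i j X" unfolding H_eq .
    moreover have "Y \<in> ?F" using X by (simp add: psd_family_def Y_def psd_0)
    ultimately show ?thesis using H_max HQ by metis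
  qed
  have t_eq: "t i j (Q i j) = 0" if ij: "i \<in> {1..Nc}" "j \<in> {1..N}" for i j
  proof -
    have le: "0 \<le> - t i j (Q i j)" if "i \<in> {1..Nc}" "j \<in> {1..N}" for i j
      using t_le psd_familyD[OF QF] that by simp
    have "(\<Sum>i=1..Nc. \<Sum>j=1..N. - t i j (Q i j)) = 0"
      using HQ unfolding H_eq by (simp add: sum_negf)
    then have "(\<Sum>j=1..N. - t i j (Q i j)) = 0"
      using ij(1) le by (intro sum_nonneg_0[of "{1..Nc}" "\<lambda>i. \<Sum>j=1..N. - t i j (Q i j)"] sum_nonneg) auto
    then have "- t i j (Q i j) = 0"
      using ij le[OF ij(1)] by (intro sum_nonneg_0[of "{1..N}" "\<lambda>j. - t i j (Q i j)"]) auto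
    then show ?thesis by simp
  qed
  show ?thesis
    using that[OF lam slack] t_le t_eq unfolding t_def by fastforce
qed

section \<open>First-order optimality of the rate sum\<close>

lemma C_BC_ln_diff:
  assumes "Q \<in> psd_family N Nc"
  shows "C_BC N Nc h w Q = (\<Sum>i=1..Nc. \<Sum>j=1..N. w j / ln 2 *
     (ln (interference N h Q i j + Re (sesq (Q i j) (h i j) (h i j))) - ln (interference N h Q i j)))"
  unfolding C_BC_eq
proof (intro sum.cong refl)
  fix i j assume ij: "i \<in> {1..Nc}" "j \<in> {1..N}"
  define a f where "a = interference N h Q i j" and "f = Re (sesq (Q i j) (h i j) (h i j))"
  have "1 \<le> a" unfolding a_def by (rule interference_ge_1[OF assms ij(1)])
  moreover have "0 \<le> f" unfolding f_def by (rule psd_form_nonneg[OF psd_familyD[OF assms ij]])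
  ultimately have "ln (1 + f / a) = ln (a + f) - ln a"
    using ln_divide_pos[of "a + f" a] by (simp add: add_divide_distrib)
  then show "w j / ln 2 * ln (1 + Re (sesq (Q i j) (h i j) (h i j)) / interference N h Q i j)
    = w j / ln 2 * (ln (interference N h Q i j + Re (sesq (Q i j) (h i j) (h i j))) - ln (interference N h Q i j))"
    unfolding a_def f_def by simp
qed

text \<open>The partial derivative of the rate sum at \<open>Q\<close> in the matrix of user \<open>j\<close> on tone \<open>i\<close>;
  the factor \<open>1 / ln 2\<close> of the binary logarithm is absorbed in the weights \<open>v\<close>.\<close>

definition rate_deriv :: "nat \<Rightarrow> (nat \<Rightarrow> nat \<Rightarrow> complex ^ 'l) \<Rightarrow> (nat \<Rightarrow> real)
    \<Rightarrow> (nat \<Rightarrow> nat \<Rightarrow> complex ^ 'l ^ 'l) \<Rightarrow> nat \<Rightarrow> nat \<Rightarrow> complex ^ 'l ^ 'l \<Rightarrow> real" where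
  "rate_deriv N h v Q i j X =
    (let a = interference N h Q i; b = (\<lambda>j. a j + Re (sesq (Q i j) (h i j) (h i j))) in
     v j / b j * Re (sesq X (h i j) (h i j))
     - (\<Sum>m=1..j-1. v m * (1 / a m - 1 / b m) * Re (sesq X (h i m) (h i m))))"

lemma rate_deriv_add: "rate_deriv N h v Q i j (X + Y) = rate_deriv N h v Q i j X + rate_deriv N h v Q i j Y"
  and rate_deriv_scale: "rate_deriv N h v Q i j (c *\<^sub>R X) = c * rate_deriv N h v Q i j X"
  by (simp_all add: rate_deriv_def Let_def sesq_add_mat sesq_scale_mat ring_distribs sum.distrib
      sum_distrib_left mult_ac)

text \<open>Regroup by the user who suffers the interference instead of the one who causes it.
  Subtracting one from \<open>interference\<close> removes the noise and leaves the part linear in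
  \<open>X\<close>.\<close>

lemma rate_deriv_sum:
  fixes X :: "nat \<Rightarrow> nat \<Rightarrow> complex ^ 'l ^ 'l" and h :: "nat \<Rightarrow> nat \<Rightarrow> complex ^ 'l"
  defines "f \<equiv> \<lambda>Q i j. Re (sesq (Q i j) (h i j) (h i j))"
  shows "(\<Sum>j=1..N. rate_deriv N h v Q i j (X i j))
    = (\<Sum>j=1..N. v j * ((interference N h X i j - 1 + f X i j) / (interference N h Q i j + f Q i j)
        - (interference N h X i j - 1) / interference N h Q i j))"
proof -
  define a where "a = interference N h Q i"
  define b where "b j = a j + f Q i j" for j
  define g where "g j k = Re (sesq (X i k) (h i j) (h i j))" for j k
  have "(\<Sum>j=1..N. rate_deriv N h v Q i j (X i j))
      = (\<Sum>k=1..N. v k / b k * g k k) - (\<Sum>k=1..N. \<Sum>j=1..k-1. v j * (1 / a j - 1 / b j) * g j k)"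
    by (simp add: rate_deriv_def Let_def a_def b_def f_def g_def sum_subtractf)
  also have "(\<Sum>k=1..N. \<Sum>j=1..k-1. v j * (1 / a j - 1 / b j) * g j k)
      = (\<Sum>j=1..N. \<Sum>k=j+1..N. v j * (1 / a j - 1 / b j) * g j k)"
    by (rule sum_triangle_swap[symmetric])
  also have "(\<Sum>k=1..N. v k / b k * g k k) - \<dots>
      = (\<Sum>j=1..N. v j * ((interference N h X i j - 1 + g j j) / b j - (interference N h X i j - 1) / a j))"
    unfolding sum_subtractf[symmetric]
  proof (intro sum.cong refl)
    fix j
    define s where "s = (\<Sum>k=j+1..N. g j k)"
    have "interference N h X i j - 1 = s" by (simp add: interference_eq s_def g_def)
    then show "v j / b j * g j j - (\<Sum>k=j+1..N. v j * (1 / a j - 1 / b j) * g j k)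
        = v j * ((interference N h X i j - 1 + g j j) / b j - (interference N h X i j - 1) / a j)"
      unfolding sum_distrib_left[symmetric] s_def[symmetric]
      by (simp add: diff_divide_distrib add_divide_distrib algebra_simps)
  qed
  finally show ?thesis by (simp add: a_def b_def f_def g_def)
qed

text \<open>Along the segment from \<open>Q\<close> to \<open>X\<close> the rate sum is a
  combination of logarithms of affine functions. Its slope at \<open>Q\<close> is the difference of
  the two sides, and a positive slope would contradict \<open>max\<close>.\<close>

lemma first_order_optimality:
  assumes Q: "Q \<in> feasible N Nc P" and X: "X \<in> feasible N Nc P"
    and max: "\<And>Y. Y \<in> feasible N Nc P \<Longrightarrow> C_BC N Nc h w Y \<le> C_BC N Nc h w Q"
  defines "v \<equiv> \<lambda>j. w j / ln 2"
  shows "(\<Sum>i=1..Nc. \<Sum>j=1..N. rate_deriv N h v Q i j (X i j))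
    \<le> (\<Sum>i=1..Nc. \<Sum>j=1..N. rate_deriv N h v Q i j (Q i j))"
proof -
  define f where "f Q i j = Re (sesq (Q i j) (h i j) (h i j))" for Q i j
  define a where "a Q i j = interference N h Q i j" for Q i j
  define Y where "Y t i j = (1 - t) *\<^sub>R Q i j + t *\<^sub>R X i j" for t :: real and i j
  have QF: "Q \<in> psd_family N Nc" and XF: "X \<in> psd_family N Nc"
    using Q X by (auto simp: feasible_def)
  have YF: "Y t \<in> psd_family N Nc" if "0 \<le> t" "t \<le> 1" for t
    using QF XF that by (auto simp: psd_family_def Y_def intro!: psd_add psd_scale)
  have Y: "Y t \<in> feasible N Nc P" if t: "0 \<le> t" "t \<le> 1" for t
    unfolding feasible_def
  proof (intro CollectI conjI allI YF[OF t])
    fix l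
    have "(\<Sum>j=1..N. \<Sum>i=1..Nc. Re (Y t i j $ l $ l))
        = (1 - t) * (\<Sum>j=1..N. \<Sum>i=1..Nc. Re (Q i j $ l $ l)) + t * (\<Sum>j=1..N. \<Sum>i=1..Nc. Re (X i j $ l $ l))"
      by (simp add: Y_def sum.distrib sum_distrib_left)
    also have "\<dots> \<le> (1 - t) * P $ l + t * P $ l"
      using Q X t by (intro add_mono mult_left_mono) (auto simp: feasible_def)
    also have "\<dots> = P $ l" by (simp add: algebra_simps)
    finally show "(\<Sum>j=1..N. \<Sum>i=1..Nc. Re (Y t i j $ l $ l)) \<le> P $ l" .
  qed
  have Y_form: "Re (sesq (Y t i j) x x) = (1 - t) * Re (sesq (Q i j) x x) + t * Re (sesq (X i j) x x)" for t i j x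
    by (simp add: Y_def sesq_add_mat sesq_scale_mat)
  have fY: "f (Y t) i j = f Q i j + t * (f X i j - f Q i j)" for t i j
    by (simp add: f_def Y_form algebra_simps)
  have aY: "a (Y t) i j = a Q i j + t * (a X i j - a Q i j)" for t i j
    unfolding a_def interference_eq
    by (simp add: Y_form algebra_simps sum.distrib sum_subtractf sum_distrib_left)
  have apos: "0 < a Q i j" if "i \<in> {1..Nc}" for i j
    using interference_ge_1[OF QF that, of h j] by (simp add: a_def)
  have fpos: "0 \<le> f Q i j" if "i \<in> {1..Nc}" "j \<in> {1..N}" for i j
    unfolding f_def by (rule psd_form_nonneg[OF psd_familyD[OF QF that]])
  \<comment> \<open>The explicit formula makes sense on both sides of zero, while \<open>Y t\<close>
    is known to be feasible only on the unit interval; so the two-sided derivative at zero is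
    available.\<close>
  define \<phi> where "\<phi> t = (\<Sum>i=1..Nc. \<Sum>j=1..N. v j *
    (ln ((a Q i j + f Q i j) + t * ((a X i j + f X i j) - (a Q i j + f Q i j)))
      - ln (a Q i j + t * (a X i j - a Q i j))))" for t
  have \<phi>: "\<phi> t = C_BC N Nc h w (Y t)" if "0 \<le> t" "t \<le> 1" for t
    unfolding C_BC_ln_diff[OF YF[OF that]] \<phi>_def v_def a_def[symmetric] f_def[symmetric] fY aY
    by (simp add: algebra_simps)
  define D where "D = (\<Sum>i=1..Nc. \<Sum>j=1..N. v j *
    (((a X i j + f X i j) - (a Q i j + f Q i j)) / (a Q i j + f Q i j) - (a X i j - a Q i j) / a Q i j))"
  have "(\<phi> has_real_derivative D) (at 0)"
    unfolding \<phi>_def D_def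
  proof (intro DERIV_sum DERIV_cmult DERIV_diff)
    fix i j assume ij: "i \<in> {1..Nc}" "j \<in> {1..N}"
    have "0 < a Q i j + f Q i j" using apos[OF ij(1), of j] fpos[OF ij] by simp
    then show "((\<lambda>t. ln ((a Q i j + f Q i j) + t * ((a X i j + f X i j) - (a Q i j + f Q i j))))
        has_real_derivative ((a X i j + f X i j) - (a Q i j + f Q i j)) / (a Q i j + f Q i j)) (at 0)"
      by (auto intro!: derivative_eq_intros)
    show "((\<lambda>t. ln (a Q i j + t * (a X i j - a Q i j)))
        has_real_derivative (a X i j - a Q i j) / a Q i j) (at 0)"
      using apos[OF ij(1), of j] by (auto intro!: derivative_eq_intros)
  qed
  have "D \<le> 0"
  proof (rule ccontr)
    assume "\<not> D \<le> 0"
    then obtain d where d: "0 < d" "\<And>t. 0 < t \<Longrightarrow> t < d \<Longrightarrow> \<phi> 0 < \<phi> (0 + t)"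
      using DERIV_pos_inc_right[OF \<open>(\<phi> has_real_derivative D) (at 0)\<close>] by (auto simp: not_le)
    define t where "t = min (d / 2) 1"
    have t: "0 < t" "t < d" "t \<le> 1" using d(1) by (auto simp: t_def)
    have "Y 0 = Q" by (intro ext) (simp add: Y_def)
    then show False
      using d(2)[OF t(1,2)] \<phi>[of 0] \<phi>[of t] t max[OF Y[of t]] by simp
  qed
  moreover have "(\<Sum>i=1..Nc. \<Sum>j=1..N. rate_deriv N h v Q i j (X i j))
      - (\<Sum>i=1..Nc. \<Sum>j=1..N. rate_deriv N h v Q i j (Q i j)) = D"
    unfolding rate_deriv_sum D_def sum_subtractf[symmetric] a_def[symmetric] f_def[symmetric]
    by (intro sum.cong refl) (simp add: diff_divide_distrib add_divide_distrib algebra_simps)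
  ultimately show ?thesis by simp
qed

section \<open>Lines with zero multiplier\<close>

definition delete_lines :: "'l set \<Rightarrow> complex ^ 'l ^ 'l \<Rightarrow> complex ^ 'l ^ 'l" where
  "delete_lines Z A = (\<chi> l m. if l \<in> Z \<or> m \<in> Z then 0 else A $ l $ m)"

text \<open>With \<open>D\<close> the coordinate projection that kills \<open>Z\<close>, the deleted
  matrix is \<open>D A D\<close>.\<close>

lemma sesq_delete_lines:
  "sesq (delete_lines Z A) x x = sesq A (\<chi> l. if l \<in> Z then 0 else x $ l) (\<chi> l. if l \<in> Z then 0 else x $ l)"
  unfolding sesq_eq_sum delete_lines_def by (intro sum.cong refl) auto

lemma sesq_delete_lines_eq:
  assumes "\<And>l. l \<in> Z \<Longrightarrow> x $ l = 0"
  shows "sesq (delete_lines Z A) x x = sesq A x x"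
proof -
  have "(\<chi> l. if l \<in> Z then 0 else x $ l) = x"
    using assms by (auto simp: Finite_Cartesian_Product.vec_eq_iff)
  then show ?thesis by (simp add: sesq_delete_lines)
qed

lemma psd_delete_lines: "psd A \<Longrightarrow> psd (delete_lines Z A)"
proof (rule psdI)
  assume A: "psd A"
  then show "hermitian (delete_lines Z A)"
    by (auto simp: hermitian_iff delete_lines_def dest: psd_hermitian)
  show "0 \<le> Re (sesq (delete_lines Z A) x x)" for x
    unfolding sesq_delete_lines by (rule psd_form_nonneg[OF A])
qed

text \<open>Users of weight zero may hear the lines in \<open>Z\<close>: their rates can change but
  are not counted.\<close>

lemma C_BC_delete_lines:
  assumes "\<And>i j l. i \<in> {1..Nc} \<Longrightarrow> j \<in> {1..N} \<Longrightarrow> w j \<noteq> 0 \<Longrightarrow> l \<in> Z \<Longrightarrow> h i j $ l = 0"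
  shows "C_BC N Nc h w (\<lambda>i j. delete_lines Z (Q i j)) = C_BC N Nc h w Q"
  unfolding C_BC_eq
proof (intro sum.cong refl)
  fix i j assume ij: "i \<in> {1..Nc}" "j \<in> {1..N}"
  show "w j / ln 2 * ln (1 + Re (sesq (delete_lines Z (Q i j)) (h i j) (h i j)) /
        interference N h (\<lambda>i j. delete_lines Z (Q i j)) i j)
     = w j / ln 2 * ln (1 + Re (sesq (Q i j) (h i j) (h i j)) / interference N h Q i j)"
  proof (cases "w j = 0")
    case False
    then have "sesq (delete_lines Z A) (h i j) (h i j) = sesq A (h i j) (h i j)" for A
      using assms ij by (intro sesq_delete_lines_eq) auto
    then show ?thesis by (simp add: interference_eq)
  qed simp
qed

lemma trace_diag_delete_lines:
  "Re (trace (diag_mat d ** delete_lines Z A)) = (\<Sum>l\<in>UNIV. if l \<in> Z then 0 else d $ l * Re (A $ l $ l))"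
  unfolding Re_trace_diag_mat by (intro sum.cong refl) (simp add: delete_lines_def)

text \<open>The sufficiency result asks for positive multipliers. Deleting the lines in
  \<open>Z\<close> from an optimum keeps its value and frees their power, so slackness makes their
  multipliers zero, while every other line turns out to have a positive one.\<close>

lemma lagrangian_maximizer:
  fixes h :: "nat \<Rightarrow> nat \<Rightarrow> complex ^ 'l" and w :: "nat \<Rightarrow> real" and P :: "real ^ 'l"
  assumes w_mono: "\<And>j k. 1 \<le> j \<Longrightarrow> j \<le> k \<Longrightarrow> k \<le> N \<Longrightarrow> w k \<le> w j"
    and w_nonneg: "\<And>j. j \<in> {1..N} \<Longrightarrow> 0 \<le> w j"
    and P: "\<And>l. 0 < P $ l"
  obtains Q lam where "Q \<in> feasible N Nc P" "\<And>l. 0 \<le> lam $ l"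
    "\<And>X. X \<in> psd_family N Nc \<Longrightarrow>
      C_BC N Nc h w X - (\<Sum>i=1..Nc. \<Sum>j=1..N. Re (trace (diag_mat lam ** X i j))) + (\<Sum>l\<in>UNIV. lam $ l * P $ l)
      \<le> C_BC N Nc h w Q"
proof -
  define Z where "Z = {l. \<forall>i\<in>{1..Nc}. \<forall>j\<in>{1..N}. w j \<noteq> 0 \<longrightarrow> h i j $ l = 0}"
  define del where "del X = (\<lambda>i j. delete_lines Z (X i j))" for X :: "nat \<Rightarrow> nat \<Rightarrow> complex ^ 'l ^ 'l"
  have del_psd: "del X \<in> psd_family N Nc" if "X \<in> psd_family N Nc" for X
    using that by (auto simp: psd_family_def del_def psd_delete_lines)
  have del_C: "C_BC N Nc h w (del X) = C_BC N Nc h w X" for X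
    unfolding del_def by (rule C_BC_delete_lines) (auto simp: Z_def)
  obtain Q0 where Q0: "Q0 \<in> feasible N Nc P"
    "\<And>X. X \<in> feasible N Nc P \<Longrightarrow> C_BC N Nc h w X \<le> C_BC N Nc h w Q0"
    using primal_attained[of P N Nc h w] P by (metis less_imp_le)
  define Q where "Q = del Q0"
  have Q0F: "Q0 \<in> psd_family N Nc" using Q0(1) by (simp add: feasible_def)
  have QF: "Q \<in> psd_family N Nc" unfolding Q_def by (rule del_psd[OF Q0F])
  have QZ: "Q i j $ l $ l = 0" if "l \<in> Z" for i j l
    using that by (simp add: Q_def del_def delete_lines_def)
  have Q: "Q \<in> feasible N Nc P"
    unfolding feasible_def
  proof (intro CollectI conjI allI QF)
    fix l
    have "(\<Sum>j=1..N. \<Sum>i=1..Nc. Re (Q i j $ l $ l)) \<le> (\<Sum>j=1..N. \<Sum>i=1..Nc. Re (Q0 i j $ l $ l))"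
      using psd_familyD[OF Q0F] by (intro sum_mono) (auto simp: Q_def del_def delete_lines_def psd_diag_nonneg)
    also have "\<dots> \<le> P $ l" using Q0(1) by (simp add: feasible_def)
    finally show "(\<Sum>j=1..N. \<Sum>i=1..Nc. Re (Q i j $ l $ l)) \<le> P $ l" .
  qed
  have max: "C_BC N Nc h w X \<le> C_BC N Nc h w Q" if "X \<in> feasible N Nc P" for X
    using Q0(2)[OF that] by (simp add: Q_def del_C)
  define v where "v = (\<lambda>j. w j / ln 2)"
  define J where "J = rate_deriv N h v Q"
  obtain lam where lam: "\<And>l. 0 \<le> lam $ l"
    and slack: "(\<Sum>l\<in>UNIV. lam $ l * (P $ l - pow_used N Nc Q l)) = 0"
    and J_le: "\<And>i j X. i \<in> {1..Nc} \<Longrightarrow> j \<in> {1..N} \<Longrightarrow> psd X \<Longrightarrow> J i j X \<le> Re (trace (diag_mat lam ** X))"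
    and J_eq: "\<And>i j. i \<in> {1..Nc} \<Longrightarrow> j \<in> {1..N} \<Longrightarrow> J i j (Q i j) = Re (trace (diag_mat lam ** Q i j))"
  proof (rule conic_multipliers[of J P Q N Nc])
    show "(\<Sum>i=1..Nc. \<Sum>j=1..N. J i j (X i j)) \<le> (\<Sum>i=1..Nc. \<Sum>j=1..N. J i j (Q i j))"
      if "X \<in> feasible N Nc P" for X
      using first_order_optimality[OF Q that max] by (simp add: J_def v_def)
  qed (use P Q in \<open>auto simp: J_def rate_deriv_add rate_deriv_scale\<close>)

  define a where "a i j = interference N h Q i j" for i j
  define b where "b i j = a i j + Re (sesq (Q i j) (h i j) (h i j))" for i j
  have apos: "0 < a i j" if "i \<in> {1..Nc}" for i j
    using interference_ge_1[OF QF that, of h j] by (simp add: a_def)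
  have bpos: "0 < b i j" if "i \<in> {1..Nc}" "j \<in> {1..N}" for i j
    using apos[OF that(1), of j] psd_form_nonneg[OF psd_familyD[OF QF that]] by (simp add: b_def add_pos_nonneg)
  have J: "J i j X = v j / b i j * Re (sesq X (h i j) (h i j))
      - (\<Sum>m=1..j-1. v m * (1 / a i m - 1 / b i m) * Re (sesq X (h i m) (h i m)))" for i j X
    by (simp add: J_def rate_deriv_def Let_def a_def b_def)

  have lam_Z: "lam $ l = 0" if "l \<in> Z" for l
  proof -
    have nn: "0 \<le> lam $ m * (P $ m - pow_used N Nc Q m)" for m
      using lam Q by (intro mult_nonneg_nonneg) (auto simp: feasible_def pow_used_def)
    have "lam $ l * (P $ l - pow_used N Nc Q l) = 0"
      using slack nn by (simp add: sum_nonneg_eq_0_iff)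
    moreover have "pow_used N Nc Q l = 0" using QZ[OF that] by (simp add: pow_used_def)
    ultimately show ?thesis using P[of l] by simp
  qed
  have lam_pos: "0 < lam $ l" if l: "l \<notin> Z" for l
  proof (rule ccontr)
    assume "\<not> 0 < lam $ l"
    then have lam0: "lam $ l = 0" using lam[of l] by simp
    obtain i where i: "i \<in> {1..Nc}" and ex: "\<exists>j. j \<in> {1..N} \<and> w j \<noteq> 0 \<and> h i j $ l \<noteq> 0"
      using l unfolding Z_def by blast
    \<comment> \<open>The first counted user who hears line \<open>l\<close>. The weights decrease,
      so all earlier users count too and hence do not hear \<open>l\<close>; power on
      \<open>l\<close> then raises this rate, disturbs no earlier user and costs nothing, contrary
      to \<open>J_le\<close>.\<close>
    define j where "j = (LEAST j. j \<in> {1..N} \<and> w j \<noteq> 0 \<and> h i j $ l \<noteq> 0)"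
    have j: "j \<in> {1..N}" "w j \<noteq> 0" "h i j $ l \<noteq> 0"
      using LeastI_ex[OF ex] unfolding j_def by blast+
    have "0 < w j" using w_nonneg[OF j(1)] j(2) by simp
    have before: "h i m $ l = 0" if "m \<in> {1..j-1}" for m
    proof (rule ccontr)
      assume "h i m $ l \<noteq> 0"
      moreover have m: "m \<in> {1..N}" "m < j" using that j(1) by auto
      moreover have "w j \<le> w m" using w_mono[of m j] that m j(1) by simp
      then have "w m \<noteq> 0" using \<open>0 < w j\<close> by simp
      ultimately show False using not_less_Least unfolding j_def by blast
    qed
    let ?X = "outer (axis l 1) :: complex ^ 'l ^ 'l"
    have form: "Re (sesq ?X x x) = (cmod (x $ l))\<^sup>2" for x
    proof -
      have "hdot x (axis l 1) = (\<Sum>m\<in>UNIV. if m = l then x $ l else 0)"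
        unfolding hdot_def by (intro sum.cong) (auto simp: axis_def)
      then show ?thesis by (simp add: sesq_outer_self)
    qed
    have "J i j ?X = v j / b i j * (cmod (h i j $ l))\<^sup>2"
      unfolding J form using before by simp
    moreover have "0 < \<dots>"
      using \<open>0 < w j\<close> j(3) bpos[OF i j(1)] by (simp add: v_def)
    moreover have "J i j ?X \<le> Re (trace (diag_mat lam ** ?X))"
      by (rule J_le[OF i j(1) psd_outer])
    moreover have "Re (trace (diag_mat lam ** ?X)) = 0"
      unfolding Re_trace_diag_mat by (intro sum.neutral) (auto simp: outer_def axis_def lam0)
    ultimately show False by simp
  qed

  \<comment> \<open>Any positive value would do on \<open>Z\<close>, since \<open>Q\<close> and all
    deleted families put no power there.\<close>
  define lam' :: "real ^ 'l" where "lam' = (\<chi> l. if l \<in> Z then 1 else lam $ l)"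
  have lam': "0 < lam' $ l" for l using lam_pos by (simp add: lam'_def)
  have trace_Q: "Re (trace (diag_mat lam' ** Q i j)) = Re (trace (diag_mat lam ** Q i j))" for i j
    unfolding Re_trace_diag_mat by (intro sum.cong refl) (simp add: lam'_def QZ)
  have trace_le: "Re (trace (diag_mat lam ** X)) \<le> Re (trace (diag_mat lam' ** X))" if "psd X" for X
    unfolding Re_trace_diag_mat
    using psd_diag_nonneg[OF that] lam_Z by (intro sum_mono mult_right_mono) (auto simp: lam'_def)
  have trace_del: "Re (trace (diag_mat lam' ** delete_lines Z A)) = Re (trace (diag_mat lam ** A))" for A
    unfolding trace_diag_delete_lines unfolding Re_trace_diag_mat
    by (intro sum.cong refl) (simp add: lam'_def lam_Z)

  have tone: "(\<Sum>j=1..N. v j * ln (1 + Re (sesq (X i j) (h i j) (h i j)) / interference N h X i j))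
      - (\<Sum>j=1..N. Re (trace (diag_mat lam' ** X i j)))
    \<le> (\<Sum>j=1..N. v j * ln (1 + Re (sesq (Q i j) (h i j) (h i j)) / a i j))
      - (\<Sum>j=1..N. Re (trace (diag_mat lam' ** Q i j)))"
    if X: "X \<in> psd_family N Nc" and i: "i \<in> {1..Nc}" for X i
  proof (rule broadcast_kkt_global_max[where b = "b i" and h = "h i"])
    show "0 < lam' $ l" for l by (rule lam')
    show "0 \<le> v j" if "j \<in> {1..N}" for j using w_nonneg[OF that] by (simp add: v_def)
    show "v (Suc j) \<le> v j" if "1 \<le> j" "j < N" for j
      using w_mono[of j "Suc j"] that by (simp add: v_def divide_right_mono)
    show "psd (Q i j)" "psd (X i j)" if "j \<in> {1..N}" for j
      using psd_familyD[OF QF i that] psd_familyD[OF X i that] by auto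
    fix j assume j: "j \<in> {1..N}"
    show "v j / b i j * Re (sesq Y (h i j) (h i j)) \<le> Re (trace (diag_mat lam' ** Y))
        + (\<Sum>m=1..j-1. v m * (1 / a i m - 1 / b i m) * Re (sesq Y (h i m) (h i m)))"
      if Y: "psd Y" for Y
      using J_le[OF i j Y] trace_le[OF Y] unfolding J by simp
    show "v j / b i j * Re (sesq (Q i j) (h i j) (h i j)) = Re (trace (diag_mat lam' ** Q i j))
        + (\<Sum>m=1..j-1. v m * (1 / a i m - 1 / b i m) * Re (sesq (Q i j) (h i m) (h i m)))"
      using J_eq[OF i j] unfolding J trace_Q by simp
  qed (simp_all add: interference_eq a_def b_def)

  have "C_BC N Nc h w X - (\<Sum>i=1..Nc. \<Sum>j=1..N. Re (trace (diag_mat lam ** X i j))) + (\<Sum>l\<in>UNIV. lam $ l * P $ l)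
      \<le> C_BC N Nc h w Q" if X: "X \<in> psd_family N Nc" for X
  proof -
    have C: "C_BC N Nc h w Y = (\<Sum>i=1..Nc. \<Sum>j=1..N. v j *
        ln (1 + Re (sesq (Y i j) (h i j) (h i j)) / interference N h Y i j))" for Y
      by (simp add: C_BC_eq v_def)
    have "C_BC N Nc h w X - (\<Sum>i=1..Nc. \<Sum>j=1..N. Re (trace (diag_mat lam ** X i j)))
        = C_BC N Nc h w (del X) - (\<Sum>i=1..Nc. \<Sum>j=1..N. Re (trace (diag_mat lam' ** del X i j)))"
      by (simp add: del_C) (simp add: del_def trace_del)
    also have "\<dots> \<le> C_BC N Nc h w Q - (\<Sum>i=1..Nc. \<Sum>j=1..N. Re (trace (diag_mat lam' ** Q i j)))"
      unfolding C sum_subtractf[symmetric]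
    proof (rule sum_mono)
      fix i assume i: "i \<in> {1..Nc}"
      from tone[OF del_psd[OF X] i]
      show "(\<Sum>j=1..N. v j * ln (1 + Re (sesq (del X i j) (h i j) (h i j)) / interference N h (del X) i j)
          - Re (trace (diag_mat lam' ** del X i j)))
        \<le> (\<Sum>j=1..N. v j * ln (1 + Re (sesq (Q i j) (h i j) (h i j)) / interference N h Q i j)
          - Re (trace (diag_mat lam' ** Q i j)))"
        by (simp add: sum_subtractf a_def)
    qed
    also have "(\<Sum>i=1..Nc. \<Sum>j=1..N. Re (trace (diag_mat lam' ** Q i j))) = (\<Sum>l\<in>UNIV. lam $ l * pow_used N Nc Q l)"
      unfolding trace_Q by (rule sum_trace_diag_mat)
    also have "\<dots> = (\<Sum>l\<in>UNIV. lam $ l * P $ l)"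
      using slack by (simp add: right_diff_distrib sum_subtractf)
    finally show ?thesis by simp
  qed
  with that[OF Q lam] show ?thesis by blast
qed

theorem mainTheorem1:
  fixes N Nc :: nat
    and h :: "nat \<Rightarrow> nat \<Rightarrow> complex ^ 'l"
    and w :: "nat \<Rightarrow> real"
    and P :: "real ^ 'l"
  assumes "1 \<le> N" and "1 \<le> Nc" and "N \<le> CARD('l)"
    and "\<And>j k. 1 \<le> j \<Longrightarrow> j < k \<Longrightarrow> k \<le> N \<Longrightarrow> w k < w j"
    and "0 \<le> w N"
    and "\<And>l. 0 < P $ l"
  shows "(\<exists>Q\<in>feasible N Nc P. ereal (C_BC N Nc h w Q) = primal_value N Nc h w P)
       \<and> (\<exists>lam. (\<forall>l. 0 \<le> lam $ l) \<and> F_BC N Nc h w P lam = dual_value N Nc h w P)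
       \<and> primal_value N Nc h w P = dual_value N Nc h w P"
proof -
  have w_mono: "w k \<le> w j" if "1 \<le> j" "j \<le> k" "k \<le> N" for j k
    using assms(4)[of j k] that by (cases "j = k") auto
  have w_nonneg: "0 \<le> w j" if "j \<in> {1..N}" for j
    using w_mono[of j N] assms(5) that by simp
  obtain Q lam where Q: "Q \<in> feasible N Nc P" and lam: "\<And>l. 0 \<le> lam $ l"
    and max: "\<And>X. X \<in> psd_family N Nc \<Longrightarrow>
      C_BC N Nc h w X - (\<Sum>i=1..Nc. \<Sum>j=1..N. Re (trace (diag_mat lam ** X i j))) + (\<Sum>l\<in>UNIV. lam $ l * P $ l)
      \<le> C_BC N Nc h w Q"
    using lagrangian_maximizer[of N w P Nc h] w_mono w_nonneg assms(6) by blast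
  let ?p = "primal_value N Nc h w P" and ?d = "dual_value N Nc h w P" and ?F = "F_BC N Nc h w P"
  have weak: "?p \<le> ?F mu" if mu: "\<And>l. 0 \<le> mu $ l" for mu
    unfolding primal_value_def
  proof (rule SUP_least)
    fix X assume X: "X \<in> feasible N Nc P"
    have "(\<Sum>i=1..Nc. \<Sum>j=1..N. Re (trace (diag_mat mu ** X i j)))
        = (\<Sum>l\<in>UNIV. mu $ l * pow_used N Nc X l)"
      by (rule sum_trace_diag_mat)
    also have "\<dots> \<le> (\<Sum>l\<in>UNIV. mu $ l * P $ l)"
      using X mu by (intro sum_mono mult_left_mono) (auto simp: feasible_def pow_used_def)
    finally have "ereal (C_BC N Nc h w X) \<le> ereal (C_BC N Nc h w X
        - (\<Sum>i=1..Nc. \<Sum>j=1..N. Re (trace (diag_mat mu ** X i j))) + (\<Sum>l\<in>UNIV. mu $ l * P $ l))"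
      by simp
    also have "\<dots> \<le> ?F mu"
      unfolding F_BC_def using X by (intro SUP_upper) (simp add: feasible_def)
    finally show "ereal (C_BC N Nc h w X) \<le> ?F mu" .
  qed
  \<comment> \<open>The inequalities close a cycle from \<open>C_BC\<close> at \<open>Q\<close>
    through the primal value, the dual value and \<open>F_BC\<close> at \<open>lam\<close> back to
    \<open>C_BC\<close> at \<open>Q\<close>. So all four agree, and both optima are
    attained.\<close>
  have "?F lam \<le> ereal (C_BC N Nc h w Q)"
    unfolding F_BC_def by (rule SUP_least) (use max in simp)
  moreover have "ereal (C_BC N Nc h w Q) \<le> ?p"
    unfolding primal_value_def using Q by (rule SUP_upper)
  moreover have "?p \<le> ?d"
    unfolding dual_value_def by (rule INF_greatest) (use weak in blast)
  moreover have "?d \<le> ?F lam"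
    unfolding dual_value_def using lam by (intro INF_lower) simp
  ultimately have "ereal (C_BC N Nc h w Q) = ?p" "?F lam = ?d" "?p = ?d"
    by (metis order_antisym order_trans)+
  with Q lam show ?thesis by blast
qed

end
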